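(* Let $\psi$ be a regular colouring, and let $\xi=(\xi^a)_{a\ge0}\in\mathcal C_0$ be the unique regular summable solution of $\psi\ltimes\xi=\psi[+1]$. Consider the quotient of $\mathbb k\langle H,X^-,X^+\rangle[[h]]$ by the smallest $h$-adically closed two-sided ideal containing the relations $$[H,X^\pm]=\pm2X^\pm,\qquad X^+X^-=\sum_{a=0}^\infty(X^-)^a(X^+)^a\xi^a(H).$$ The assignment $H\mapsto H$, $X^\pm\mapsto X^\pm$ induces an isomorphism of $\mathbb k[[h]]$-algebras from this quotient onto $U_h(\psi)$.
   Context: $\mathbb k$ is a field of characteristic zero, and $\mathbb k[[h]]$ is the ring of formal power series over $\mathbb k$. For a $\mathbb k$-vector space $V_0$, $V_0[[h]]$ denotes the module of formal series $\sum_{m\ge0}v_mh^m$ with $v_m\in V_0$. $\mathfrak a$ is the Lie algebra over $\mathbb k$ generated by $H,X^-,X^+$ subject to $[H,X^\pm]=\pm2X^\pm$. We set $U_h(\mathfrak a):=U(\mathfrak a)[[h]]$. A colouring is a sequence $\psi=(\psi^k)_{k\ge1}$ of functions $\psi^k:\mathbb Z\to\mathbb k[[h]]$ satisfying: - (C1) $\psi^k(n)\equiv k(n-k+1)\bmod h$; - (C2) $\psi^{n+1}(n)=0$ for all $n\ge0$; - (C3) $\psi^{n+k+1}(n)=\psi^k(-n-2)$ for all $k\ge1$ and all $n\ge0$. Write $\psi^k(n)=\sum_m\psi^k_m(n)h^m$. The colouring $\psi$ is regular if, for each $m$, there is $P_m\in\mathbb k[x,y]$ with $\psi^k_m(n)=P_m(k,n)$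 for all $k\ge1$ and $n\in\mathbb Z$. $V_h(n,\psi)$ is the representation of $U_h(\mathfrak a)$ on $(\bigoplus_{k\ge0}\mathbb k b_k)[[h]]$ with the following action: - $H.b_k=(n-2k)b_k$; - $X^-.b_k=b_{k+1}$; - $X^+.b_0=0$, and $X^+.b_k=\psi^k(n)b_{k-1}$ for $k\ge1$. $U_h(\psi)$ is the quotient of $U_h(\mathfrak a)$ by the two-sided ideal of elements that act by zero on every $V_h(n,\psi)$, $n\in\mathbb Z$. Sequences. $\mathcal C_0$ is the module of sequences $f=(f^k)_{k\ge0}$ of functions $\mathbb Z\to\mathbb k[[h]]$, with $f^k(n)=\sum_mf^k_m(n)h^m$. - $f$ is summable if for each $m$ one has $f^k_m\equiv0$ for $k$ large. - $f$ is regular if each $f^k_m$ is a polynomial in $n$, of degree bounded independently of $k$ for each fixed $m$. - For regular $\xi$, set $\xi^a(H)=\sum_m\xi^a_m(H)h^m\in\mathbb k[H][[h]]$. $\psi[+1]\in\mathcal C_0$ is defined by $(\psi[+1])^k=\psi^{k+1}$. For $\xi\in\mathcal C_0$, $(\psi\ltimes\xi)^k(n)=\sum_{a=0}^k\big(\prod_{b=k-a+1}^k\psi^b(n)\big)\xi^a(n-2k)$, where the empty product is $1$. *)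

theory Defs
  imports "HOL-Algebra.QuotRing" "HOL-Computational_Algebra.Formal_Power_Series"
    "HOL-Computational_Algebra.Polynomial"
begin

text \<open>A colouring: psi k n stands for psi^k(n); only k \<ge> 1 is meaningful.\<close>
definition colouring :: "(nat \<Rightarrow> int \<Rightarrow> 'k::field_char_0 fps) \<Rightarrow> bool" where
  "colouring psi \<longleftrightarrow>
     (\<forall>k\<ge>1. \<forall>n. fps_nth (psi k n) 0 = of_int (int k * (n - int k + 1))) \<and>
     (\<forall>n::nat. psi (n + 1) (int n) = 0) \<and>
     (\<forall>k\<ge>1. \<forall>n::nat. psi (n + k + 1) (int n) = psi k (- int n - 2))"

definition regular_colouring :: "(nat \<Rightarrow> int \<Rightarrow> 'k::field_char_0 fps) \<Rightarrow> bool" where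
  "regular_colouring psi \<longleftrightarrow> colouring psi \<and>
     (\<forall>m. \<exists>(d::nat) (c::nat \<Rightarrow> nat \<Rightarrow> 'k). \<forall>k\<ge>1. \<forall>n.
        fps_nth (psi k n) m = (\<Sum>i\<le>d. \<Sum>j\<le>d. c i j * of_nat k ^ i * of_int n ^ j))"

definition seq_summable :: "(nat \<Rightarrow> int \<Rightarrow> 'k::field_char_0 fps) \<Rightarrow> bool" where
  "seq_summable f \<longleftrightarrow> (\<forall>m. \<exists>K. \<forall>k\<ge>K. \<forall>n. fps_nth (f k n) m = 0)"

definition seq_regular :: "(nat \<Rightarrow> int \<Rightarrow> 'k::field_char_0 fps) \<Rightarrow> bool" where
  "seq_regular f \<longleftrightarrow> (\<forall>m. \<exists>d. \<forall>k. \<exists>p::'k poly. degree p \<le> d \<and>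
        (\<forall>n. fps_nth (f k n) m = poly p (of_int n)))"

definition ltimes :: "(nat \<Rightarrow> int \<Rightarrow> 'k::field_char_0 fps) \<Rightarrow> (nat \<Rightarrow> int \<Rightarrow> 'k fps) \<Rightarrow> nat \<Rightarrow> int \<Rightarrow> 'k fps" where
  "ltimes psi xi k n = (\<Sum>a\<le>k. (\<Prod>b\<in>{k - a + 1..k}. psi b n) * xi a (n - 2 * int k))"

definition shift1 :: "(nat \<Rightarrow> int \<Rightarrow> 'k fps) \<Rightarrow> nat \<Rightarrow> int \<Rightarrow> 'k fps" where
  "shift1 psi k = psi (k + 1)"

definition xipoly :: "(nat \<Rightarrow> int \<Rightarrow> 'k::field_char_0 fps) \<Rightarrow> nat \<Rightarrow> nat \<Rightarrow> 'k poly" where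
  "xipoly xi a m = (SOME p. \<forall>n::int. poly p (of_int n) = fps_nth (xi a n) m)"

datatype gen = GH | GXm | GXp

text \<open>k<H,X^-,X^+>: finitely supported functions on words; product = concatenation.\<close>
definition FA :: "(gen list \<Rightarrow> 'k::field_char_0) ring" where
  "FA = \<lparr>partial_object.carrier = {f. finite {w. f w \<noteq> 0}},
         monoid.mult = (\<lambda>f g w. \<Sum>i\<le>length w. f (take i w) * g (drop i w)),
         monoid.one = (\<lambda>w. if w = [] then 1 else 0),
         ring.zero = (\<lambda>w. 0),
         ring.add = (\<lambda>f g w. f w + g w)\<rparr>"

text \<open>k<H,X^-,X^+>[[h]]: f m is the coefficient of h^m.\<close>
definition FH :: "(nat \<Rightarrow> gen list \<Rightarrow> 'k::field_char_0) ring" where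
  "FH = \<lparr>partial_object.carrier = {f. \<forall>m. finite {w. f m w \<noteq> 0}},
         monoid.mult = (\<lambda>f g m w. \<Sum>i\<le>m. \<Sum>j\<le>length w. f i (take j w) * g (m - i) (drop j w)),
         monoid.one = (\<lambda>m w. if m = 0 \<and> w = [] then 1 else 0),
         ring.zero = (\<lambda>m w. 0),
         ring.add = (\<lambda>f g m w. f m w + g m w)\<rparr>"

definition ind :: "gen list \<Rightarrow> gen list \<Rightarrow> 'k::field_char_0" where
  "ind w u = (if u = w then 1 else 0)"

definition relA_Hp :: "gen list \<Rightarrow> 'k::field_char_0" where
  "relA_Hp u = ind [GH, GXp] u - ind [GXp, GH] u - 2 * ind [GXp] u"
definition relA_Hm :: "gen list \<Rightarrow> 'k::field_char_0" where
  "relA_Hm u = ind [GH, GXm] u - ind [GXm, GH] u + 2 * ind [GXm] u"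

definition rel_Hp :: "nat \<Rightarrow> gen list \<Rightarrow> 'k::field_char_0" where
  "rel_Hp m u = (if m = 0 then relA_Hp u else 0)"
definition rel_Hm :: "nat \<Rightarrow> gen list \<Rightarrow> 'k::field_char_0" where
  "rel_Hm m u = (if m = 0 then relA_Hm u else 0)"

text \<open>X^+X^- - sum_a (X^-)^a (X^+)^a xi^a(H); the coefficient of h^m at the word
  (X^-)^a (X^+)^a H^i is the i-th coefficient of xi^a_m.\<close>
definition rel_XX :: "(nat \<Rightarrow> int \<Rightarrow> 'k::field_char_0 fps) \<Rightarrow> nat \<Rightarrow> gen list \<Rightarrow> 'k" where
  "rel_XX xi m u = (if m = 0 then ind [GXp, GXm] u else 0)
     - (\<Sum>a\<le>length u. \<Sum>i\<le>length u.
          if u = replicate a GXm @ replicate a GXp @ replicate i GH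
          then coeff (xipoly xi a m) i else 0)"

definition hclosed :: "(nat \<Rightarrow> gen list \<Rightarrow> 'k::field_char_0) set \<Rightarrow> bool" where
  "hclosed S \<longleftrightarrow> S \<subseteq> carrier FH \<and>
     (\<forall>f\<in>carrier FH. (\<forall>N. \<exists>g\<in>S. \<forall>m<N. f m = g m) \<longrightarrow> f \<in> S)"

definition Jideal :: "(nat \<Rightarrow> int \<Rightarrow> 'k::field_char_0 fps) \<Rightarrow> (nat \<Rightarrow> gen list \<Rightarrow> 'k) set" where
  "Jideal xi = \<Inter>{I. ideal I FH \<and> hclosed I \<and> {rel_Hp, rel_Hm, rel_XX xi} \<subseteq> I}"

definition Ia :: "(gen list \<Rightarrow> 'k::field_char_0) set" where
  "Ia = genideal FA {relA_Hp, relA_Hm}"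

definition Ua :: "(gen list \<Rightarrow> 'k::field_char_0) set ring" where
  "Ua = FA Quot Ia"

definition Uh :: "(nat \<Rightarrow> (gen list \<Rightarrow> 'k::field_char_0) set) ring" where
  "Uh = \<lparr>partial_object.carrier = {u. \<forall>m. u m \<in> carrier Ua},
         monoid.mult = (\<lambda>u v m. finsum Ua (\<lambda>i. u i \<otimes>\<^bsub>Ua\<^esub> v (m - i)) {..m}),
         monoid.one = (\<lambda>m. if m = 0 then \<one>\<^bsub>Ua\<^esub> else \<zero>\<^bsub>Ua\<^esub>),
         ring.zero = (\<lambda>m. \<zero>\<^bsub>Ua\<^esub>),
         ring.add = (\<lambda>u v m. u m \<oplus>\<^bsub>Ua\<^esub> v m)\<rparr>"

text \<open>Elements of V_h(n,psi) = (oplus_k k b_k)[[h]]: v k is the k[[h]]-coefficient of b_k,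
  with finitely many nonzero b_k-components at each power of h.\<close>
definition Vcarrier :: "(nat \<Rightarrow> 'k::field_char_0 fps) set" where
  "Vcarrier = {v. \<forall>m. finite {k. fps_nth (v k) m \<noteq> 0}}"

text \<open>Action of generators: H b_k = (n-2k) b_k, X^- b_k = b_(k+1), X^+ b_k = psi^k(n) b_(k-1), X^+ b_0 = 0.\<close>
definition letact :: "(nat \<Rightarrow> int \<Rightarrow> 'k::field_char_0 fps) \<Rightarrow> int \<Rightarrow> gen \<Rightarrow> (nat \<Rightarrow> 'k fps) \<Rightarrow> nat \<Rightarrow> 'k fps" where
  "letact psi n g v k = (case g of
       GH \<Rightarrow> of_int (n - 2 * int k) * v k
     | GXm \<Rightarrow> (if k = 0 then 0 else v (k - 1))
     | GXp \<Rightarrow> psi (Suc k) n * v (Suc k))"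

definition wordact :: "(nat \<Rightarrow> int \<Rightarrow> 'k::field_char_0 fps) \<Rightarrow> int \<Rightarrow> gen list \<Rightarrow> (nat \<Rightarrow> 'k fps) \<Rightarrow> nat \<Rightarrow> 'k fps" where
  "wordact psi n w v = foldr (letact psi n) w v"

definition faact :: "(nat \<Rightarrow> int \<Rightarrow> 'k::field_char_0 fps) \<Rightarrow> int \<Rightarrow> (gen list \<Rightarrow> 'k) \<Rightarrow> (nat \<Rightarrow> 'k fps) \<Rightarrow> nat \<Rightarrow> 'k fps" where
  "faact psi n f v k = (\<Sum>w\<in>{w. f w \<noteq> 0}. fps_const (f w) * wordact psi n w v k)"

definition fhact :: "(nat \<Rightarrow> int \<Rightarrow> 'k::field_char_0 fps) \<Rightarrow> int \<Rightarrow> (nat \<Rightarrow> gen list \<Rightarrow> 'k) \<Rightarrow> (nat \<Rightarrow> 'k fps) \<Rightarrow> nat \<Rightarrow> 'k fps" where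
  "fhact psi n g v k = Abs_fps (\<lambda>p. \<Sum>m\<le>p. fps_nth (faact psi n (g m) v k) (p - m))"

text \<open>Action of U_h(a) via representatives (well defined since the relations of U(a) act by zero).\<close>
definition rep :: "'a set \<Rightarrow> 'a" where
  "rep c = (SOME f. f \<in> c)"

definition uhact :: "(nat \<Rightarrow> int \<Rightarrow> 'k::field_char_0 fps) \<Rightarrow> int \<Rightarrow> (nat \<Rightarrow> (gen list \<Rightarrow> 'k) set) \<Rightarrow> (nat \<Rightarrow> 'k fps) \<Rightarrow> nat \<Rightarrow> 'k fps" where
  "uhact psi n u v = fhact psi n (\<lambda>m. rep (u m)) v"

definition Ann :: "(nat \<Rightarrow> int \<Rightarrow> 'k::field_char_0 fps) \<Rightarrow> (nat \<Rightarrow> (gen list \<Rightarrow> 'k) set) set" where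
  "Ann psi = {u \<in> carrier Uh. \<forall>n::int. \<forall>v\<in>Vcarrier. uhact psi n u v = (\<lambda>k. 0)}"

definition Upsi :: "(nat \<Rightarrow> int \<Rightarrow> 'k::field_char_0 fps) \<Rightarrow> (nat \<Rightarrow> (gen list \<Rightarrow> 'k) set) set ring" where
  "Upsi psi = Uh Quot Ann psi"

definition canon :: "(nat \<Rightarrow> gen list \<Rightarrow> 'k::field_char_0) \<Rightarrow> nat \<Rightarrow> (gen list \<Rightarrow> 'k) set" where
  "canon f = (\<lambda>m. a_r_coset FA Ia (f m))"

end

theory Submission
  imports Defs
begin

text \<open>
  The assignment extends to a surjection of the completed free algebra onto \<open>U\<^sub>h(\<psi>)\<close> whose kernel
  \<open>K\<close> consists of the series acting by zero on every \<open>V\<^sub>h(n,\<psi>)\<close>. The equation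
  \<open>\<psi> \<ltimes> \<xi> = \<psi>[+1]\<close> says precisely that the last relation acts by zero, so the closed ideal \<open>J\<close> of
  relations lies in \<open>K\<close>. Conversely, modulo \<open>h\<close> the modules are the Verma modules of \<open>sl\<^sub>2\<close>. A combination
  of words \<open>(X\<^sup>-)\<^sup>a (X\<^sup>+)\<^sup>b H\<^sup>i\<close> which kills all of them is zero; this forces the last relation to reduce to
  \<open>X\<^sup>+X\<^sup>- - X\<^sup>-X\<^sup>+ - H\<close>, and since every word can be rewritten into such words, the constant term of any
  \<open>f \<in> K\<close> is the constant term of some \<open>F \<in> J\<close>. Then \<open>f = F + h f'\<close> with \<open>f' \<in> K\<close> because the modules
  are torsion free; iterating, \<open>f\<close> is an \<open>h\<close>-adic limit of elements of \<open>J\<close>.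
\<close>

subsection \<open>The free algebra and its formal power series\<close>

definition conc :: "(gen list \<Rightarrow> 'k::field_char_0) \<Rightarrow> (gen list \<Rightarrow> 'k) \<Rightarrow> gen list \<Rightarrow> 'k" where
  "conc f g w = (\<Sum>i\<le>length w. f (take i w) * g (drop i w))"

definition supp :: "('a \<Rightarrow> 'k::zero) \<Rightarrow> 'a set" where
  "supp f = {w. f w \<noteq> 0}"

lemma FA_simps:
  "carrier FA = {f. finite (supp f)}"
  "f \<otimes>\<^bsub>FA\<^esub> g = conc f g"
  "\<one>\<^bsub>FA\<^esub> = ind []"
  "\<zero>\<^bsub>FA\<^esub> = (\<lambda>w. 0)"
  "f \<oplus>\<^bsub>FA\<^esub> g = (\<lambda>w. f w + g w)"
  by (auto simp: FA_def conc_def supp_def ind_def fun_eq_iff)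

lemma FH_simps:
  "carrier FH = {f. \<forall>m. f m \<in> carrier FA}"
  "f \<otimes>\<^bsub>FH\<^esub> g = (\<lambda>m w. \<Sum>i\<le>m. conc (f i) (g (m - i)) w)"
  "\<one>\<^bsub>FH\<^esub> = (\<lambda>m w. if m = 0 then ind [] w else 0)"
  "\<zero>\<^bsub>FH\<^esub> = (\<lambda>m w. 0)"
  "f \<oplus>\<^bsub>FH\<^esub> g = (\<lambda>m w. f m w + g m w)"
  by (auto simp: FH_def FA_def conc_def ind_def fun_eq_iff)

text \<open>A cut position is recovered as the length of the first piece, so the convolution is a
  sum over factorizations of \<open>w\<close>. In this form sums over words can be regrouped as sums
  over pairs of words.\<close>

lemma conc_eq_sum_pairs:
  assumes "finite (supp f)" "finite (supp g)"
  shows "conc f g w =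
    (\<Sum>p\<in>{p \<in> supp f \<times> supp g. fst p @ snd p = w}. f (fst p) * g (snd p))"
proof -
  have inj: "inj_on (\<lambda>i. (take i w, drop i w)) {..length w}"
    by (auto simp: inj_on_def) (metis length_take min.absorb2)
  have "conc f g w =
      (\<Sum>p\<in>(\<lambda>i. (take i w, drop i w)) ` {..length w}. f (fst p) * g (snd p))"
    by (simp add: conc_def sum.reindex[OF inj])
  also have "\<dots> = (\<Sum>p\<in>{p \<in> supp f \<times> supp g. fst p @ snd p = w}. f (fst p) * g (snd p))"
  proof (rule sum.mono_neutral_right)
    show "{p \<in> supp f \<times> supp g. fst p @ snd p = w} \<subseteq> (\<lambda>i. (take i w, drop i w)) ` {..length w}"
    proof clarify
      fix u v assume "w = fst (u, v) @ snd (u, v)"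
      thus "(u, v) \<in> (\<lambda>i. (take i (fst (u, v) @ snd (u, v)), drop i (fst (u, v) @ snd (u, v)))) `
          {..length (fst (u, v) @ snd (u, v))}"
        by (intro image_eqI[of _ _ "length u"]) auto
    qed
  qed (auto simp: supp_def)
  finally show ?thesis .
qed

lemma supp_conc_subset:
  assumes "finite (supp f)" "finite (supp g)"
  shows "supp (conc f g) \<subseteq> (\<lambda>p. fst p @ snd p) ` (supp f \<times> supp g)"
proof
  fix w assume "w \<in> supp (conc f g)"
  hence "(\<Sum>p\<in>{p \<in> supp f \<times> supp g. fst p @ snd p = w}. f (fst p) * g (snd p)) \<noteq> 0"
    by (simp only: conc_eq_sum_pairs[OF assms] supp_def[of "conc f g"] mem_Collect_eq not_False_eq_True)
  hence "{p \<in> supp f \<times> supp g. fst p @ snd p = w} \<noteq> {}"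
    by (rule contrapos_nn) (simp only: sum.empty)
  thus "w \<in> (\<lambda>p. fst p @ snd p) ` (supp f \<times> supp g)" by blast
qed

lemma finite_supp_conc:
  assumes "finite (supp f)" "finite (supp g)"
  shows "finite (supp (conc f g))"
  using supp_conc_subset[OF assms] assms by (meson finite_SigmaI finite_imageI finite_subset)

lemma finite_supp_add:
  fixes f g :: "'a \<Rightarrow> 'k::monoid_add"
  assumes "finite (supp f)" "finite (supp g)"
  shows "finite (supp (\<lambda>w. f w + g w))"
  by (rule finite_subset[OF _ finite_UnI[OF assms]]) (auto simp: supp_def)

lemma finite_supp_sum:
  fixes f :: "'i \<Rightarrow> 'a \<Rightarrow> 'k::comm_monoid_add"
  assumes "\<And>i. i \<in> A \<Longrightarrow> finite (supp (f i))"
  shows "finite (supp (\<lambda>w. \<Sum>i\<in>A. f i w))"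
proof (cases "finite A")
  case True
  have "supp (\<lambda>w. \<Sum>i\<in>A. f i w) \<subseteq> (\<Union>i\<in>A. supp (f i))"
    by (auto simp: supp_def elim: sum.not_neutral_contains_not_neutral)
  thus ?thesis using True assms by (meson finite_UN finite_subset)
qed (simp add: supp_def)

lemma finite_supp_smult:
  fixes f :: "'a \<Rightarrow> 'k::mult_zero"
  assumes "finite (supp f)"
  shows "finite (supp (\<lambda>w. c * f w))"
  using assms by (rule finite_subset[rotated]) (auto simp: supp_def)

lemma finite_supp_ind [simp]: "finite (supp (ind u))"
  by (rule finite_subset[of _ "{u}"]) (auto simp: supp_def ind_def)

lemma finite_supp_zero [simp]: "finite (supp (\<lambda>w. 0))"
  by (simp add: supp_def)

text \<open>Cutting a word into three pieces amounts to choosing three lengths that add up to its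
  length, so the reindexing of triples behind associativity of power series multiplication
  applies.\<close>

lemma conc_assoc: "conc (conc f g) h = conc f (conc g h)"
proof
  fix w
  let ?F = "\<lambda>i d (e::nat). f (take i w) * g (take d (drop i w)) * h (drop (i + d) w)"
  have "conc (conc f g) h w = (\<Sum>j=0..length w. \<Sum>i=0..j. ?F i (j - i) (length w - j))"
    unfolding conc_def atMost_atLeast0 sum_distrib_right
    by (intro sum.cong) (auto simp: min_def drop_take)
  also have "\<dots> = (\<Sum>j=0..length w. \<Sum>i=0..length w - j. ?F j i (length w - j - i))"
    by (rule fps_mult_assoc_lemma)
  also have "\<dots> = conc f (conc g h) w"
    unfolding conc_def atMost_atLeast0 sum_distrib_left
    by (intro sum.cong) (auto simp: mult.assoc add.commute)
  finally show "conc (conc f g) h w = conc f (conc g h) w" .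
qed

lemma conc_sum_left: "conc (\<lambda>w. \<Sum>i\<in>A. f i w) g w = (\<Sum>i\<in>A. conc (f i) g w)"
  unfolding conc_def sum_distrib_right by (rule sum.swap)

lemma conc_sum_right: "conc g (\<lambda>w. \<Sum>i\<in>A. f i w) w = (\<Sum>i\<in>A. conc g (f i) w)"
  unfolding conc_def sum_distrib_left by (rule sum.swap)

lemma conc_add_left: "conc (\<lambda>w. f w + g w) h w = conc f h w + conc g h w"
  by (simp add: conc_def algebra_simps sum.distrib)

lemma conc_add_right: "conc h (\<lambda>w. f w + g w) w = conc h f w + conc h g w"
  by (simp add: conc_def algebra_simps sum.distrib)

lemma conc_zero_left [simp]: "conc (\<lambda>w. 0) h = (\<lambda>w. 0)"
  by (simp add: conc_def fun_eq_iff)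

lemma conc_zero_right [simp]: "conc h (\<lambda>w. 0) = (\<lambda>w. 0)"
  by (simp add: conc_def fun_eq_iff)

text \<open>Scalars sit in the free algebra as multiples of the empty word; this is why ring ideals
  are closed under scalar multiplication.\<close>

lemma conc_smult_one_left: "conc (\<lambda>w. c * ind [] w) f = (\<lambda>w. c * f w)"
proof
  fix w
  have "conc (\<lambda>w. c * ind [] w) f w
      = (\<Sum>i\<in>{0}. (c * ind [] (take i w)) * f (drop i w))"
    unfolding conc_def by (rule sum.mono_neutral_right) (auto simp: ind_def)
  thus "conc (\<lambda>w. c * ind [] w) f w = c * f w" by (simp add: ind_def)
qed

lemma conc_one_left [simp]: "conc (ind []) f = f"
  using conc_smult_one_left[of 1 f] by simp

lemma conc_one_right [simp]: "conc f (ind []) = f"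
proof
  fix w
  have "conc f (ind []) w = (\<Sum>i\<in>{length w}. f (take i w) * ind [] (drop i w))"
    unfolding conc_def by (rule sum.mono_neutral_right) (auto simp: ind_def)
  thus "conc f (ind []) w = f w" by (simp add: ind_def)
qed

lemma conc_ind_ind: "conc (ind u) (ind v) = (ind (u @ v) :: gen list \<Rightarrow> 'k::field_char_0)"
proof
  fix w
  have s: "supp (ind u :: _ \<Rightarrow> 'k) = {u}" "supp (ind v :: _ \<Rightarrow> 'k) = {v}"
    by (auto simp: supp_def ind_def)
  have "conc (ind u) (ind v) w =
      (\<Sum>p\<in>{p \<in> {u} \<times> {v}. fst p @ snd p = w}. ind u (fst p) * (ind v (snd p) :: 'k))"
    by (subst conc_eq_sum_pairs) (simp_all add: s)
  also have "{p \<in> {u} \<times> {v}. fst p @ snd p = w} = (if w = u @ v then {(u, v)} else {})"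
    by auto
  finally have "conc (ind u) (ind v) w = (if w = u @ v then ind u u * ind v v else (0 :: 'k))"
    by simp
  thus "conc (ind u) (ind v) w = (ind (u @ v) w :: 'k)"
    unfolding ind_def[of u u] ind_def[of v v] ind_def[of "u @ v"] by simp
qed

lemma ring_FA: "ring (FA :: (gen list \<Rightarrow> 'k::field_char_0) ring)"
proof (rule ringI)
  show "abelian_group (FA :: (gen list \<Rightarrow> 'k) ring)"
  proof (rule abelian_groupI)
    fix x :: "gen list \<Rightarrow> 'k" assume "x \<in> carrier FA"
    thus "\<exists>y\<in>carrier FA. y \<oplus>\<^bsub>FA\<^esub> x = \<zero>\<^bsub>FA\<^esub>"
      by (intro bexI[of _ "\<lambda>w. - x w"]) (auto simp: FA_simps supp_def)
  qed (auto simp: FA_simps finite_supp_add add_ac)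
  show "monoid (FA :: (gen list \<Rightarrow> 'k) ring)"
    by (rule monoidI) (auto simp: FA_simps finite_supp_conc conc_assoc)
qed (auto simp: FA_simps conc_add_left conc_add_right fun_eq_iff)

text \<open>The reindexing of triples again, now applied to exponents of \<open>h\<close> instead of
  lengths of words.\<close>

lemma FH_mult_assoc: "(f \<otimes>\<^bsub>FH\<^esub> g) \<otimes>\<^bsub>FH\<^esub> h = f \<otimes>\<^bsub>FH\<^esub> (g \<otimes>\<^bsub>FH\<^esub> h)"
proof (intro ext)
  fix m w
  let ?F = "\<lambda>i d e. conc (f i) (conc (g d) (h e)) w"
  have "((f \<otimes>\<^bsub>FH\<^esub> g) \<otimes>\<^bsub>FH\<^esub> h) m w = (\<Sum>j=0..m. \<Sum>i=0..j. ?F i (j - i) (m - j))"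
    by (simp add: FH_simps conc_sum_left conc_assoc atMost_atLeast0)
  also have "\<dots> = (\<Sum>j=0..m. \<Sum>i=0..m - j. ?F j i (m - j - i))"
    by (rule fps_mult_assoc_lemma)
  also have "\<dots> = (f \<otimes>\<^bsub>FH\<^esub> (g \<otimes>\<^bsub>FH\<^esub> h)) m w"
    by (simp add: FH_simps conc_sum_right atMost_atLeast0)
  finally show "((f \<otimes>\<^bsub>FH\<^esub> g) \<otimes>\<^bsub>FH\<^esub> h) m w = (f \<otimes>\<^bsub>FH\<^esub> (g \<otimes>\<^bsub>FH\<^esub> h)) m w" .
qed

text \<open>The element \<open>h\<^sup>j f\<close>.\<close>
definition hshift :: "nat \<Rightarrow> (gen list \<Rightarrow> 'k::field_char_0) \<Rightarrow> nat \<Rightarrow> gen list \<Rightarrow> 'k" where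
  "hshift j f m = (if m = j then f else (\<lambda>w. 0))"

lemma FH_mult_hshift_left:
  "hshift j a \<otimes>\<^bsub>FH\<^esub> f = (\<lambda>m. if m < j then (\<lambda>w. 0) else conc a (f (m - j)))"
proof (intro ext)
  fix m w
  have "(hshift j a \<otimes>\<^bsub>FH\<^esub> f) m w = (\<Sum>i\<in>(if m < j then {} else {j}). conc (hshift j a i) (f (m - i)) w)"
    unfolding FH_simps by (rule sum.mono_neutral_right) (auto simp: hshift_def)
  thus "(hshift j a \<otimes>\<^bsub>FH\<^esub> f) m w = (if m < j then (\<lambda>w. 0) else conc a (f (m - j))) w"
    by (auto simp: hshift_def)
qed

lemma FH_mult_const_right:
  "f \<otimes>\<^bsub>FH\<^esub> hshift 0 a = (\<lambda>m. conc (f m) a)"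
proof (intro ext)
  fix m w
  have "(f \<otimes>\<^bsub>FH\<^esub> hshift 0 a) m w = (\<Sum>i\<in>{m}. conc (f i) (hshift 0 a (m - i)) w)"
    unfolding FH_simps by (rule sum.mono_neutral_right) (auto simp: hshift_def)
  thus "(f \<otimes>\<^bsub>FH\<^esub> hshift 0 a) m w = conc (f m) a w"
    by (auto simp: hshift_def)
qed

lemma hshift_carrier: "a \<in> carrier FA \<Longrightarrow> hshift j a \<in> carrier FH"
  by (auto simp: FH_simps FA_simps hshift_def)

lemma FH_one: "\<one>\<^bsub>FH\<^esub> = hshift 0 (ind [])"
  by (auto simp: FH_simps hshift_def fun_eq_iff)

lemma ring_FH: "ring (FH :: (nat \<Rightarrow> gen list \<Rightarrow> 'k::field_char_0) ring)"
proof (rule ringI)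
  show "abelian_group (FH :: (nat \<Rightarrow> gen list \<Rightarrow> 'k) ring)"
  proof (rule abelian_groupI)
    fix x :: "nat \<Rightarrow> gen list \<Rightarrow> 'k" assume "x \<in> carrier FH"
    thus "\<exists>y\<in>carrier FH. y \<oplus>\<^bsub>FH\<^esub> x = \<zero>\<^bsub>FH\<^esub>"
      by (intro bexI[of _ "\<lambda>m w. - x m w"]) (auto simp: FH_simps FA_simps supp_def)
  qed (auto simp: FH_simps FA_simps finite_supp_add add_ac)
  show "monoid (FH :: (nat \<Rightarrow> gen list \<Rightarrow> 'k) ring)"
  proof (rule monoidI)
    fix x y :: "nat \<Rightarrow> gen list \<Rightarrow> 'k"
    assume "x \<in> carrier FH" "y \<in> carrier FH"
    thus "x \<otimes>\<^bsub>FH\<^esub> y \<in> carrier FH"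
      by (auto simp: FH_simps FA_simps intro!: finite_supp_sum finite_supp_conc)
  next
    show "\<one>\<^bsub>FH\<^esub> \<in> carrier (FH :: (nat \<Rightarrow> gen list \<Rightarrow> 'k) ring)"
      unfolding FH_one by (rule hshift_carrier) (simp add: FA_simps)
  qed (auto simp: FH_mult_assoc FH_one FH_mult_const_right FH_mult_hshift_left)
qed (auto simp: FH_simps conc_add_left conc_add_right fun_eq_iff sum.distrib)

lemma a_inv_FA: "f \<in> carrier FA \<Longrightarrow> \<ominus>\<^bsub>FA\<^esub> f = (\<lambda>w. - f w)"
  by (rule abelian_group.minus_equality[OF ring.is_abelian_group[OF ring_FA]])
    (auto simp: FA_simps supp_def)

lemma a_inv_FH: "f \<in> carrier FH \<Longrightarrow> \<ominus>\<^bsub>FH\<^esub> f = (\<lambda>m w. - f m w)"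
  by (rule abelian_group.minus_equality[OF ring.is_abelian_group[OF ring_FH]])
    (auto simp: FH_simps FA_simps supp_def)

subsection \<open>The action on the modules\<close>

text \<open>The series \<open>\<Sum>\<^sub>m h\<^sup>m a\<^sub>m\<close>; its coefficients are finite sums, so no topology is needed.\<close>
definition hsum :: "(nat \<Rightarrow> 'k::comm_ring_1 fps) \<Rightarrow> 'k fps" where
  "hsum a = Abs_fps (\<lambda>p. \<Sum>m\<le>p. fps_nth (a m) (p - m))"

lemma hsum_nth [simp]: "fps_nth (hsum a) p = (\<Sum>m\<le>p. fps_nth (a m) (p - m))"
  by (simp add: hsum_def)

lemma hsum_add: "hsum (\<lambda>m. a m + b m) = hsum a + hsum b"
  by (simp add: fps_eq_iff sum.distrib)

lemma hsum_zero [simp]: "hsum (\<lambda>m. 0) = 0"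
  by (simp add: fps_eq_iff)

lemma hsum_sum: "hsum (\<lambda>m. \<Sum>i\<in>A. a i m) = (\<Sum>i\<in>A. hsum (a i))"
  by (induction A rule: infinite_finite_induct) (simp_all add: hsum_add)

lemma hsum_mult_left: "hsum (\<lambda>m. c * a m) = c * hsum a"
proof (rule fps_ext)
  fix p
  have "fps_nth (hsum (\<lambda>m. c * a m)) p =
      (\<Sum>m\<le>p. \<Sum>i\<le>p - m. fps_nth c i * fps_nth (a m) (p - m - i))"
    by (simp add: fps_mult_nth atLeast0AtMost)
  also have "\<dots> = (\<Sum>(m, i)\<in>(SIGMA m:{..p}. {..p - m}). fps_nth c i * fps_nth (a m) (p - m - i))"
    by (simp add: sum.Sigma)
  also have "\<dots> = (\<Sum>(i, m)\<in>(SIGMA i:{..p}. {..p - i}). fps_nth c i * fps_nth (a m) (p - i - m))"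
    by (rule sum.reindex_bij_witness[of _ "\<lambda>(i, m). (m, i)" "\<lambda>(m, i). (i, m)"])
      (auto simp: add.commute)
  also have "\<dots> = (\<Sum>i\<le>p. \<Sum>m\<le>p - i. fps_nth c i * fps_nth (a m) (p - i - m))"
    by (simp add: sum.Sigma)
  also have "\<dots> = fps_nth (c * hsum a) p"
    by (simp add: fps_mult_nth atLeast0AtMost sum_distrib_left)
  finally show "fps_nth (hsum (\<lambda>m. c * a m)) p = fps_nth (c * hsum a) p" .
qed

text \<open>Reassembles a series from its coefficients: \<open>rel_XX\<close> stores
  \<open>xi\<close> one power of \<open>h\<close> at a time, whereas \<open>ltimes\<close> uses
  whole series.\<close>

lemma hsum_const: "hsum (\<lambda>m. fps_const (fps_nth c m)) = c"
proof (rule fps_ext)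
  fix p
  have "fps_nth (hsum (\<lambda>m. fps_const (fps_nth c m))) p
      = (\<Sum>m\<in>{p}. fps_nth (fps_const (fps_nth c m)) (p - m))"
    unfolding hsum_nth by (rule sum.mono_neutral_right) auto
  thus "fps_nth (hsum (\<lambda>m. fps_const (fps_nth c m))) p = fps_nth c p" by simp
qed

text \<open>Extracts a factor \<open>h\<close> when the constant term vanishes. Cancelling that
  factor later is how torsion freeness of the modules enters.\<close>

lemma hsum_shift:
  assumes "a 0 = 0"
  shows "hsum a = fps_X * hsum (\<lambda>m. a (Suc m))"
proof (rule fps_ext)
  fix p
  show "fps_nth (hsum a) p = fps_nth (fps_X * hsum (\<lambda>m. a (Suc m))) p"
    using assms by (cases p) (auto simp: sum.atMost_Suc_shift simp del: sum.atMost_Suc)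
qed

lemma fps_const_sum:
  "fps_const (\<Sum>i\<in>A. c i :: 'k::comm_ring_1) = (\<Sum>i\<in>A. fps_const (c i))"
  by (induction A rule: infinite_finite_induct) (simp_all flip: fps_const_add)

lemma letact_sum:
  "letact psi n g (\<lambda>k. \<Sum>i\<in>A. c i * V i k) = (\<lambda>k. \<Sum>i\<in>A. c i * letact psi n g (V i) k)"
  by (rule ext, cases g) (auto simp: letact_def sum_distrib_left mult_ac)

lemma wordact_Nil [simp]: "wordact psi n [] v = v"
  by (simp add: wordact_def)

lemma wordact_Cons: "wordact psi n (g # w) v = letact psi n g (wordact psi n w v)"
  by (simp add: wordact_def)

lemma wordact_append: "wordact psi n (u @ w) v = wordact psi n u (wordact psi n w v)"
  by (simp add: wordact_def)

lemma wordact_sum: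
  "wordact psi n w (\<lambda>k. \<Sum>i\<in>A. c i * V i k) = (\<lambda>k. \<Sum>i\<in>A. c i * wordact psi n w (V i) k)"
  by (induction w) (simp_all add: wordact_Cons letact_sum)

text \<open>Generators shift coordinates and multiply them by series, and both operations pass
  through an \<open>h\<close>-adic sum.\<close>

lemma letact_hsum:
  "letact psi n g (\<lambda>k. hsum (\<lambda>m. V m k)) = (\<lambda>k. hsum (\<lambda>m. letact psi n g (V m) k))"
  by (rule ext, cases g) (auto simp: letact_def hsum_mult_left)

lemma wordact_hsum:
  "wordact psi n w (\<lambda>k. hsum (\<lambda>m. V m k)) = (\<lambda>k. hsum (\<lambda>m. wordact psi n w (V m) k))"
  by (induction w) (simp_all add: wordact_Cons letact_hsum)

lemma faact_superset:
  assumes "finite S" "supp f \<subseteq> S"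
  shows "faact psi n f v k = (\<Sum>w\<in>S. fps_const (f w) * wordact psi n w v k)"
  unfolding faact_def using assms
  by (intro sum.mono_neutral_left) (auto simp: supp_def)

lemma faact_ind: "faact psi n (ind u) v = wordact psi n u v"
  by (rule ext, subst faact_superset[of "{u}"]) (auto simp: supp_def ind_def)

lemma faact_smult: "faact psi n (\<lambda>w. c * f w) v k = fps_const c * faact psi n f v k"
proof (cases "c = 0")
  case False
  hence "supp (\<lambda>w. c * f w) = supp f" by (auto simp: supp_def)
  thus ?thesis
    by (simp add: faact_def supp_def sum_distrib_left mult_ac flip: fps_const_mult)
qed (simp add: faact_def)

lemma faact_add:
  assumes "finite (supp f)" "finite (supp g)"
  shows "faact psi n (\<lambda>w. f w + g w) v k = faact psi n f v k + faact psi n g v k"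
proof -
  have "faact psi n h v k = (\<Sum>w\<in>supp f \<union> supp g. fps_const (h w) * wordact psi n w v k)"
    if "supp h \<subseteq> supp f \<union> supp g" for h
    using that assms by (intro faact_superset) auto
  moreover have "supp (\<lambda>w. f w + g w) \<subseteq> supp f \<union> supp g"
    by (auto simp: supp_def)
  ultimately show ?thesis
    by (simp add: algebra_simps sum.distrib flip: fps_const_add)
qed

lemma faact_zero [simp]: "faact psi n (\<lambda>w. 0) v k = 0"
  by (simp add: faact_def)

lemma faact_sum:
  assumes "\<And>i. i \<in> A \<Longrightarrow> finite (supp (f i))"
  shows "faact psi n (\<lambda>w. \<Sum>i\<in>A. f i w) v k = (\<Sum>i\<in>A. faact psi n (f i) v k)"
  using assms
  by (induction A rule: infinite_finite_induct) (simp_all add: faact_add finite_supp_sum)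

lemma faact_diff:
  assumes "finite (supp f)" "finite (supp g)"
  shows "faact psi n (\<lambda>w. f w - g w) v k = faact psi n f v k - faact psi n g v k"
  using faact_add[OF assms(1) finite_supp_smult[OF assms(2), of "-1"], of psi n v k]
    faact_smult[of psi n "-1" g v k]
  by (simp flip: fps_const_neg)

text \<open>Grouping pairs of words by their concatenation turns the convolution into a double sum,
  and a concatenated word acts as the composite of its two parts.\<close>

lemma faact_conc:
  assumes "finite (supp f)" "finite (supp g)"
  shows "faact psi n (conc f g) v = faact psi n f (faact psi n g v)"
proof
  fix k
  let ?P = "(\<lambda>p. fst p @ snd p) ` (supp f \<times> supp g)"
  let ?T = "\<lambda>w. wordact psi n w v k"
  have fin: "finite ?P" using assms by blast
  have "faact psi n (conc f g) v k = (\<Sum>w\<in>?P. fps_const (conc f g w) * ?T w)"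
    using supp_conc_subset[OF assms] fin by (rule faact_superset[rotated])
  also have "\<dots> = (\<Sum>w\<in>?P. \<Sum>p\<in>{p. p \<in> supp f \<times> supp g \<and> fst p @ snd p = w}.
      fps_const (f (fst p) * g (snd p)) * ?T (fst p @ snd p))"
  proof (rule sum.cong[OF refl])
    fix w
    show "fps_const (conc f g w) * ?T w = (\<Sum>p\<in>{p. p \<in> supp f \<times> supp g \<and> fst p @ snd p = w}.
      fps_const (f (fst p) * g (snd p)) * ?T (fst p @ snd p))"
      unfolding conc_eq_sum_pairs[OF assms] fps_const_sum sum_distrib_right
      by (rule sum.cong) auto
  qed
  also have "\<dots> = (\<Sum>p\<in>supp f \<times> supp g. fps_const (f (fst p) * g (snd p)) * ?T (fst p @ snd p))"
    using assms by (intro sum.image_gen[symmetric]) auto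
  also have "\<dots> = (\<Sum>u\<in>supp f. \<Sum>w\<in>supp g. fps_const (f u * g w) * ?T (u @ w))"
    by (simp add: sum.cartesian_product case_prod_unfold)
  also have "\<dots> = (\<Sum>u\<in>supp f. fps_const (f u) *
      (\<Sum>w\<in>supp g. fps_const (g w) * wordact psi n u (wordact psi n w v) k))"
    by (simp add: sum_distrib_left wordact_append mult.assoc flip: fps_const_mult)
  also have "\<dots> = (\<Sum>u\<in>supp f. fps_const (f u) * wordact psi n u (faact psi n g v) k)"
  proof -
    have "faact psi n g v = (\<lambda>k. \<Sum>w\<in>supp g. fps_const (g w) * wordact psi n w v k)"
      by (simp add: faact_def supp_def fun_eq_iff)
    thus ?thesis by (simp add: wordact_sum)
  qed
  also have "\<dots> = faact psi n f (faact psi n g v) k"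
    by (simp add: faact_def supp_def)
  finally show "faact psi n (conc f g) v k = faact psi n f (faact psi n g v) k" .
qed

lemma faact_hsum:
  "faact psi n f (\<lambda>k. hsum (\<lambda>m. V m k)) k = hsum (\<lambda>m. faact psi n f (V m) k)"
  by (simp add: faact_def wordact_hsum hsum_sum hsum_mult_left)

lemma fhact_eq_hsum: "fhact psi n f v = (\<lambda>k. hsum (\<lambda>m. faact psi n (f m) v k))"
  by (simp add: fhact_def hsum_def fun_eq_iff)

text \<open>The exponent \<open>p\<close> of \<open>h\<close> splits into three parts: one from
  \<open>f\<close>, one from \<open>g\<close>, and one from the coefficient of the resulting
  vector.\<close>

lemma fhact_mult:
  assumes "f \<in> carrier FH" "g \<in> carrier FH"
  shows "fhact psi n (f \<otimes>\<^bsub>FH\<^esub> g) v = fhact psi n f (fhact psi n g v)"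
proof (rule ext, rule fps_ext)
  fix k p
  have fin: "finite (supp (f m))" "finite (supp (g m))" for m
    using assms by (auto simp: FH_simps FA_simps)
  let ?F = "\<lambda>i d e. fps_nth (faact psi n (f i) (faact psi n (g d) v) k) e"
  have "fps_nth (fhact psi n (f \<otimes>\<^bsub>FH\<^esub> g) v k) p = (\<Sum>j=0..p. \<Sum>i=0..j. ?F i (j - i) (p - j))"
    by (simp add: fhact_eq_hsum FH_simps faact_sum finite_supp_conc fin faact_conc
        fps_sum_nth atMost_atLeast0)
  also have "\<dots> = (\<Sum>j=0..p. \<Sum>i=0..p - j. ?F j i (p - j - i))"
    by (rule fps_mult_assoc_lemma)
  also have "\<dots> = fps_nth (fhact psi n f (fhact psi n g v) k) p"
    by (simp add: fhact_eq_hsum faact_hsum atMost_atLeast0)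
  finally show "fps_nth (fhact psi n (f \<otimes>\<^bsub>FH\<^esub> g) v k) p =
    fps_nth (fhact psi n f (fhact psi n g v) k) p" .
qed

lemma fhact_add:
  assumes "f \<in> carrier FH" "g \<in> carrier FH"
  shows "fhact psi n (f \<oplus>\<^bsub>FH\<^esub> g) v k = fhact psi n f v k + fhact psi n g v k"
  using assms by (simp add: fhact_eq_hsum FH_simps FA_simps faact_add hsum_add)

lemma fhact_diff:
  assumes "f \<in> carrier FH" "g \<in> carrier FH"
  shows "fhact psi n (\<lambda>m w. f m w - g m w) v k = fhact psi n f v k - fhact psi n g v k"
  using assms by (simp add: fhact_eq_hsum FH_simps FA_simps faact_diff fps_eq_iff sum_subtractf)

lemma fhact_vec_zero: "fhact psi n f (\<lambda>k. 0) = (\<lambda>k. 0)"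
proof -
  have "wordact psi n w (\<lambda>k. 0) = (\<lambda>k. 0)" for w
    by (induction w) (auto simp: wordact_Cons letact_def fun_eq_iff split: gen.splits)
  thus ?thesis by (simp add: fhact_eq_hsum faact_def)
qed

text \<open>Shifting indices preserves finiteness. So does multiplying coordinates by series: the
  coefficient of \<open>h^m\<close> in a product involves only coefficients up to \<open>m\<close>,
  hence a finite union of finite sets.\<close>

lemma Vcarrier_letact:
  assumes "v \<in> Vcarrier"
  shows "letact psi n g v \<in> Vcarrier"
proof -
  have fin: "finite {k. fps_nth (v k) m \<noteq> 0}" for m
    using assms by (simp add: Vcarrier_def)
  have mul: "finite {k. fps_nth (c k * u k) m \<noteq> 0}"
    if "\<And>m. finite {k. fps_nth (u k) m \<noteq> 0}" for c u :: "nat \<Rightarrow> 'a fps" and m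
  proof (rule finite_subset)
    show "{k. fps_nth (c k * u k) m \<noteq> 0} \<subseteq> (\<Union>i\<in>{..m}. {k. fps_nth (u k) i \<noteq> 0})"
    proof
      fix k assume "k \<in> {k. fps_nth (c k * u k) m \<noteq> 0}"
      then obtain i where "fps_nth (c k) i * fps_nth (u k) (m - i) \<noteq> 0"
        unfolding mem_Collect_eq fps_mult_nth by (rule sum.not_neutral_contains_not_neutral)
      thus "k \<in> (\<Union>i\<in>{..m}. {k. fps_nth (u k) i \<noteq> 0})"
        by (intro UN_I[of "m - i"]) auto
    qed
  qed (use that in auto)
  show ?thesis
  proof (cases g)
    case GH
    thus ?thesis using mul[OF fin] by (simp add: Vcarrier_def letact_def)
  next
    case GXm
    have "{k. fps_nth (letact psi n g v k) m \<noteq> 0} \<subseteq> Suc ` {k. fps_nth (v k) m \<noteq> 0}" for m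
    proof
      fix k assume "k \<in> {k. fps_nth (letact psi n g v k) m \<noteq> 0}"
      thus "k \<in> Suc ` {k. fps_nth (v k) m \<noteq> 0}"
        using GXm by (cases k) (auto simp: letact_def)
    qed
    hence "finite {k. fps_nth (letact psi n g v k) m \<noteq> 0}" for m
      by (rule finite_subset) (intro finite_imageI fin)
    thus ?thesis by (simp add: Vcarrier_def)
  next
    case GXp
    have "finite {k. fps_nth (v (Suc k)) m \<noteq> 0}" for m
      using finite_vimageI[OF fin[of m], of Suc] by (simp add: vimage_def)
    from mul[OF this] show ?thesis using GXp by (simp add: Vcarrier_def letact_def)
  qed
qed

text \<open>Makes the annihilator a right ideal: \<open>f\<close> kills \<open>x v\<close> because
  \<open>x v\<close> is again a vector of the module.\<close>

lemma Vcarrier_fhact: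
  assumes "f \<in> carrier FH" "v \<in> Vcarrier"
  shows "fhact psi n f v \<in> Vcarrier"
proof -
  have w: "wordact psi n w v \<in> Vcarrier" for w
    by (induction w) (simp_all add: assms wordact_Cons Vcarrier_letact)
  have fin: "finite (supp (f i))" for i
    using assms by (auto simp: FH_simps FA_simps)
  have "{k. fps_nth (fhact psi n f v k) m \<noteq> 0} \<subseteq>
     (\<Union>i\<in>{..m}. \<Union>w\<in>supp (f i). {k. fps_nth (wordact psi n w v k) (m - i) \<noteq> 0})" for m
  proof
    fix k assume "k \<in> {k. fps_nth (fhact psi n f v k) m \<noteq> 0}"
    then obtain i where i: "i \<le> m" "fps_nth (faact psi n (f i) v k) (m - i) \<noteq> 0"
      unfolding mem_Collect_eq fhact_eq_hsum hsum_nth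
      by (rule sum.not_neutral_contains_not_neutral) auto
    from i(2) obtain w where "w \<in> supp (f i)"
      "fps_nth (fps_const (f i w) * wordact psi n w v k) (m - i) \<noteq> 0"
      unfolding faact_def fps_sum_nth supp_def[symmetric]
      by (rule sum.not_neutral_contains_not_neutral)
    with i show "k \<in> (\<Union>i\<in>{..m}. \<Union>w\<in>supp (f i). {k. fps_nth (wordact psi n w v k) (m - i) \<noteq> 0})"
      by auto
  qed
  moreover have "finite (\<Union>i\<in>{..m}. \<Union>w\<in>supp (f i). {k. fps_nth (wordact psi n w v k) (m - i) \<noteq> 0})" for m
    using w fin by (auto simp: Vcarrier_def)
  ultimately show ?thesis
    unfolding Vcarrier_def by (blast intro: finite_subset)
qed

subsection \<open>Normal words\<close>

text \<open>These are the ordered (PBW) monomials of U(sl_2); the sum in the last relation involves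
  those with \<open>a = b\<close>.\<close>

definition nword :: "nat \<Rightarrow> nat \<Rightarrow> nat \<Rightarrow> gen list" where
  "nword a b i = replicate a GXm @ replicate b GXp @ replicate i GH"

definition normal_words :: "gen list set" where
  "normal_words = {nword a b i | a b i. True}"

text \<open>The exponents are recovered as letter counts.\<close>

lemma nword_eq_iff: "nword a b i = nword a' b' i' \<longleftrightarrow> a = a' \<and> b = b' \<and> i = i'"
proof
  assume eq: "nword a b i = nword a' b' i'"
  have c: "count_list (replicate p x) y = (if x = y then p else 0)" for p and x y :: gen
    by (induction p) auto
  from arg_cong[OF eq, of "\<lambda>w. count_list w GXm"] arg_cong[OF eq, of "\<lambda>w. count_list w GXp"]
    arg_cong[OF eq, of "\<lambda>w. count_list w GH"]
  show "a = a' \<and> b = b' \<and> i = i'"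
    by (simp add: nword_def c)
qed simp

lemma length_nword [simp]: "length (nword a b i) = a + b + i"
  by (simp add: nword_def)

lemma wordact_replicate_GH:
  "wordact psi n (replicate i GH) v k = of_int (n - 2 * int k) ^ i * v k"
  by (induction i) (simp_all add: wordact_Cons letact_def)

lemma wordact_replicate_GXp:
  "wordact psi n (replicate b GXp) v k = (\<Prod>t\<in>{k + 1..k + b}. psi t n) * v (k + b)"
proof (induction b arbitrary: k)
  case (Suc b)
  have "{k + 1..k + Suc b} = insert (Suc k) {Suc k + 1..Suc k + b}" by auto
  thus ?case by (simp add: wordact_Cons letact_def Suc mult.assoc)
qed simp

lemma wordact_replicate_GXm:
  "wordact psi n (replicate a GXm) v k = (if k < a then 0 else v (k - a))"
proof (induction a arbitrary: k)
  case (Suc a)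
  thus ?case by (cases k) (auto simp: wordact_Cons letact_def)
qed simp

text \<open>The rightmost letters act first, so coordinate \<open>k\<close> of the result is read
  from coordinate \<open>k - a + b\<close> of \<open>v\<close>, whose weight \<open>H\<close> sees.
  The case \<open>k < a\<close> is separate because natural subtraction truncates.\<close>

lemma wordact_nword:
  "wordact psi n (nword a b i) v k = (if k < a then 0 else
     (\<Prod>t\<in>{k - a + 1..k - a + b}. psi t n) *
     (of_int (n - 2 * int (k - a + b)) ^ i * v (k - a + b)))"
  by (simp add: nword_def wordact_append wordact_replicate_GH wordact_replicate_GXp
      wordact_replicate_GXm)

lemma fps_prod_nth_0: "fps_nth (\<Prod>x\<in>A. f x) 0 = (\<Prod>x\<in>A. fps_nth (f x :: 'k::comm_ring_1 fps) 0)"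
  by (induction A rule: infinite_finite_induct) simp_all

lemma fps_of_int_nth_0: "fps_nth (of_int z :: 'k::comm_ring_1 fps) 0 = of_int z"
  by (simp add: fps_of_int[symmetric])

text \<open>The Verma modules jointly separate PBW combinations. Take the least power
  \<open>b\<close> of \<open>X^+\<close> that occurs and apply \<open>g\<close> to the basis vector
  of index \<open>b\<close>: coordinate \<open>a\<close> is a nonzero product times a polynomial in
  the weight, for every large \<open>n\<close>. The polynomial has infinitely many roots, so its
  coefficients vanish.\<close>

lemma normal_eq_zero_if_acts_zero:
  fixes psi :: "nat \<Rightarrow> int \<Rightarrow> 'k::field_char_0 fps"
  assumes col: "colouring psi" and fin: "finite (supp g)" and nf: "supp g \<subseteq> normal_words"
    and act: "\<And>n v k. v \<in> Vcarrier \<Longrightarrow> fps_nth (faact psi n g v k) 0 = 0"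
  shows "g = (\<lambda>w. 0)"
proof (rule ccontr)
  assume "g \<noteq> (\<lambda>w. 0)"
  then obtain w0 where "w0 \<in> supp g" by (auto simp: supp_def)
  moreover from this nf obtain a0 b0 c0 where "w0 = nword a0 b0 c0"
    unfolding normal_words_def by blast
  ultimately have ex: "\<exists>a i. nword a b0 i \<in> supp g" by blast
  define b where "b = (LEAST b. \<exists>a i. nword a b i \<in> supp g)"
  obtain a i0 where i0: "nword a b i0 \<in> supp g"
    using LeastI[of "\<lambda>b. \<exists>a i. nword a b i \<in> supp g", OF ex] unfolding b_def by blast
  have minb: "b \<le> b'" if "nword a' b' i' \<in> supp g" for a' b' i'
    unfolding b_def by (rule Least_le) (use that in blast)
  define I where "I = {i. nword a b i \<in> supp g}"
  have inj: "inj_on (nword a b) I" by (auto simp: inj_on_def nword_eq_iff)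
  have "finite (nword a b ` I)" using fin by (rule finite_subset[rotated]) (auto simp: I_def)
  hence finI: "finite I" using inj by (rule finite_imageD)
  txt \<open>By minimality of \<open>b\<close>, only the words \<open>nword a b i\<close> contribute to the coordinate \<open>a\<close> of \<open>g\<close>
    applied to the basis vector with index \<open>b\<close>.\<close>
  define P where "P = (\<Sum>i\<in>I. monom (g (nword a b i)) i)"
  define v :: "nat \<Rightarrow> 'k fps" where "v = (\<lambda>k. if k = b then 1 else 0)"
  have v: "v \<in> Vcarrier"
    unfolding Vcarrier_def
  proof (intro CollectI allI)
    fix m show "finite {k. fps_nth (v k) m \<noteq> 0}"
      by (rule finite_subset[of _ "{b}"]) (auto simp: v_def split: if_splits)
  qed
  have eval: "(\<Prod>t\<in>{1..b}. of_int (int t * (n - int t + 1))) * poly P (of_int (n - 2 * int b)) = 0" for n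
  proof -
    have "faact psi n g v a = (\<Sum>w\<in>supp g. fps_const (g w) * wordact psi n w v a)"
      by (simp add: faact_def supp_def)
    also have "\<dots> = (\<Sum>w\<in>nword a b ` I. fps_const (g w) * wordact psi n w v a)"
    proof (rule sum.mono_neutral_right[OF fin])
      show "\<forall>w\<in>supp g - nword a b ` I. fps_const (g w) * wordact psi n w v a = 0"
      proof
        fix w assume w: "w \<in> supp g - nword a b ` I"
        then obtain a' b' i' where w': "w = nword a' b' i'" using nf by (auto simp: normal_words_def)
        \<comment> \<open>If \<open>a' \<le> a\<close>, coordinate \<open>a\<close> of the image is
          read from index \<open>a - a' + b'\<close>; as \<open>b \<le> b'\<close>, this equals
          \<open>b\<close> only for the excluded pair.\<close>
        with w have "b \<le> b'" "\<not> (a' = a \<and> b' = b)" using minb by (auto simp: I_def)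
        hence "a < a' \<or> a - a' + b' \<noteq> b" by auto
        thus "fps_const (g w) * wordact psi n w v a = 0"
          by (auto simp: w' wordact_nword v_def)
      qed
    qed (auto simp: I_def)
    also have "\<dots> = (\<Sum>i\<in>I. fps_const (g (nword a b i)) *
        ((\<Prod>t\<in>{1..b}. psi t n) * of_int (n - 2 * int b) ^ i))"
      by (simp add: sum.reindex[OF inj] wordact_nword v_def)
    finally have "0 = fps_nth (\<Sum>i\<in>I. fps_const (g (nword a b i)) *
        ((\<Prod>t\<in>{1..b}. psi t n) * of_int (n - 2 * int b) ^ i)) 0"
      using act[OF v, of n a] by simp
    also have "\<dots> = (\<Sum>i\<in>I. g (nword a b i) * ((\<Prod>t\<in>{1..b}. fps_nth (psi t n) 0)
        * of_int (n - 2 * int b) ^ i))"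
      by (simp add: fps_sum_nth fps_prod_nth_0 fps_of_int_nth_0 fps_power_zeroth
          del: of_int_diff of_int_mult)
    also have "\<dots> = (\<Prod>t\<in>{1..b}. fps_nth (psi t n) 0) * poly P (of_int (n - 2 * int b))"
      by (simp add: P_def poly_sum poly_monom sum_distrib_left mult_ac)
    also have "(\<Prod>t\<in>{1..b}. fps_nth (psi t n) 0) = (\<Prod>t\<in>{1..b}. of_int (int t * (n - int t + 1)))"
      using col by (intro prod.cong) (auto simp: colouring_def)
    finally show ?thesis by simp
  qed
  \<comment> \<open>Take \<open>n = b + j\<close>: the weight \<open>n - 2b\<close> is
    \<open>j - b\<close>, and every factor \<open>t (n - t + 1)\<close> with
    \<open>1 \<le> t \<le> b\<close> is positive as an integer, so the product can be cancelled in
    characteristic zero.\<close>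
  have "poly P (of_int (int j - int b)) = 0" for j :: nat
  proof -
    have "(\<Prod>t\<in>{1..b}. (of_int (int t * (int (b + j) - int t + 1)) :: 'k)) \<noteq> 0"
      by (auto simp: prod_zero_iff simp del: of_int_mult of_int_diff of_int_add)
    with eval[of "int (b + j)"] show ?thesis by (simp add: algebra_simps)
  qed
  hence "range (\<lambda>j::nat. of_int (int j - int b)) \<subseteq> {x. poly P x = 0}" by auto
  moreover have "infinite (range (\<lambda>j::nat. of_int (int j - int b) :: 'k))"
    by (rule range_inj_infinite) (simp add: inj_on_def)
  ultimately have "P = 0" by (metis poly_roots_finite finite_subset)
  hence "coeff P i0 = 0" by simp
  moreover have "coeff P i0 = g (nword a b i0)"
    using i0 finI by (simp add: P_def coeff_sum I_def sum.delta)
  ultimately show False using i0 by (simp add: supp_def)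
qed

section \<open>Rewriting words into normal words\<close>

fun grank :: "gen \<Rightarrow> nat" where
  "grank GXm = 0" | "grank GXp = 1" | "grank GH = 2"

text \<open>A word without descents is sorted for the order \<open>X^- < X^+ < H\<close>. In the
  induction, a new first letter of rank at least 1 excludes \<open>X^-\<close> from the rest, and
  one of rank 2 also excludes \<open>X^+\<close>.\<close>

lemma nword_if_no_descent:
  assumes "\<And>p x y q. u = p @ [x, y] @ q \<Longrightarrow> grank x \<le> grank y"
  shows "u \<in> normal_words"
  using assms
proof (induction u)
  case Nil
  have "[] = nword 0 0 0" by (simp add: nword_def)
  thus ?case unfolding normal_words_def by blast
next
  case (Cons x u)
  have "u \<in> normal_words" using Cons.prems by (intro Cons.IH) (metis append_Cons)
  then obtain a b i where u: "u = nword a b i" by (auto simp: normal_words_def)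
  have hd: "grank x \<le> grank y" if "u = y # q" for y q
    using Cons.prems[of "[]" x y q] that by simp
  have a: "a = 0" if "grank x \<ge> 1"
    using hd[of GXm] that by (cases a) (auto simp: u nword_def)
  have b: "b = 0" if "grank x \<ge> 2"
    using hd[of GXp] a that by (cases b) (auto simp: u nword_def)
  have "x # u = (case x of GXm \<Rightarrow> nword (Suc a) b i | GXp \<Rightarrow> nword a (Suc b) i | GH \<Rightarrow> nword a b (Suc i))"
    using a b by (cases x) (auto simp: u nword_def)
  thus ?case unfolding normal_words_def by (cases x) auto
qed

text \<open>A common shape for the three relations of sl_2, so that one rewriting step treats all
  descents alike.\<close>

definition commrel :: "gen \<Rightarrow> gen \<Rightarrow> 'k::field_char_0 \<Rightarrow> gen \<Rightarrow> gen list \<Rightarrow> 'k" where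
  "commrel x y c z w = ind [x, y] w - ind [y, x] w - c * ind [z] w"

lemma relA_commrel:
  "relA_Hp = commrel GH GXp 2 GXp" "relA_Hm = commrel GH GXm (-2) GXm"
  by (auto simp: relA_Hp_def relA_Hm_def commrel_def fun_eq_iff)

lemma finite_supp_diff:
  fixes f g :: "'a \<Rightarrow> 'k::group_add"
  assumes "finite (supp f)" "finite (supp g)"
  shows "finite (supp (\<lambda>w. f w - g w))"
  by (rule finite_subset[OF _ finite_UnI[OF assms]]) (auto simp: supp_def)

lemma commrel_carrier: "commrel x y c z \<in> carrier FA"
  unfolding commrel_def[abs_def] FA_simps
  by (auto intro!: finite_supp_diff finite_supp_smult)

lemma conc_commrel:
  "conc (ind p) (conc (commrel x y c z) (ind q)) =
     (\<lambda>w. ind (p @ [x, y] @ q) w - ind (p @ [y, x] @ q) w - c * ind (p @ [z] @ q) w)"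
proof -
  have lin: "conc (\<lambda>w. f w - g w - c * h w) k = (\<lambda>w. conc f k w - conc g k w - c * conc h k w)"
    "conc k (\<lambda>w. f w - g w - c * h w) = (\<lambda>w. conc k f w - conc k g w - c * conc k h w)"
    for f g h k
    by (simp_all add: conc_def fun_eq_iff algebra_simps sum_subtractf sum_distrib_left sum.distrib)
  show ?thesis unfolding commrel_def[abs_def] lin by (simp add: conc_ind_ind)
qed

text \<open>Kept abstract for the rewriting; it is instantiated with the constant terms of the
  elements of \<open>Jideal xi\<close>.\<close>

locale fa_ideal =
  fixes S :: "(gen list \<Rightarrow> 'k::field_char_0) set"
  assumes ideal: "ideal S FA"
begin

lemma add: "f \<in> S \<Longrightarrow> g \<in> S \<Longrightarrow> (\<lambda>w. f w + g w) \<in> S"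
  using additive_subgroup.a_closed[OF ideal.axioms(1)[OF ideal]] by (simp add: FA_simps)

lemma zero: "(\<lambda>w. 0) \<in> S"
  using additive_subgroup.zero_closed[OF ideal.axioms(1)[OF ideal]] by (simp add: FA_simps)

lemma conc_left: "f \<in> S \<Longrightarrow> finite (supp g) \<Longrightarrow> conc g f \<in> S"
  using ideal.I_l_closed[OF ideal, of f g] by (simp add: FA_simps)

lemma conc_right: "f \<in> S \<Longrightarrow> finite (supp g) \<Longrightarrow> conc f g \<in> S"
  using ideal.I_r_closed[OF ideal, of f g] by (simp add: FA_simps)

lemma smult: "f \<in> S \<Longrightarrow> (\<lambda>w. c * f w) \<in> S"
  using conc_left[of f "\<lambda>w. c * ind [] w"] by (simp add: conc_smult_one_left finite_supp_smult)

definition reducible_to_normal :: "(gen list \<Rightarrow> 'k) \<Rightarrow> bool" where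
  "reducible_to_normal f \<longleftrightarrow>
     (\<exists>g. finite (supp g) \<and> supp g \<subseteq> normal_words \<and> (\<lambda>w. f w - g w) \<in> S)"

lemma reducible_add:
  assumes "reducible_to_normal f" "reducible_to_normal g"
  shows "reducible_to_normal (\<lambda>w. f w + g w)"
proof -
  from assms obtain f' g' where f': "finite (supp f')" "supp f' \<subseteq> normal_words" "(\<lambda>w. f w - f' w) \<in> S"
    and g': "finite (supp g')" "supp g' \<subseteq> normal_words" "(\<lambda>w. g w - g' w) \<in> S"
    by (auto simp: reducible_to_normal_def)
  have "supp (\<lambda>w. f' w + g' w) \<subseteq> normal_words" using f'(2) g'(2) by (fastforce simp: supp_def)
  thus ?thesis unfolding reducible_to_normal_def
    using finite_supp_add[OF f'(1) g'(1)] add[OF f'(3) g'(3)]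
    by (intro exI[of _ "\<lambda>w. f' w + g' w"]) (simp add: algebra_simps)
qed

lemma reducible_smult:
  assumes "reducible_to_normal f"
  shows "reducible_to_normal (\<lambda>w. c * f w)"
proof -
  from assms obtain f' where f': "finite (supp f')" "supp f' \<subseteq> normal_words" "(\<lambda>w. f w - f' w) \<in> S"
    by (auto simp: reducible_to_normal_def)
  have "supp (\<lambda>w. c * f' w) \<subseteq> normal_words" using f'(2) by (fastforce simp: supp_def)
  thus ?thesis unfolding reducible_to_normal_def
    using finite_supp_smult[OF f'(1)] smult[OF f'(3), of c]
    by (intro exI[of _ "\<lambda>w. c * f' w"]) (simp add: algebra_simps)
qed

lemma reducible_if_mem: "f \<in> S \<Longrightarrow> reducible_to_normal f"
  unfolding reducible_to_normal_def by (intro exI[of _ "\<lambda>w. 0"]) (simp add: supp_def)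

lemma reducible_ind:
  assumes rels: "commrel GH GXp 2 GXp \<in> S" "commrel GH GXm (-2) GXm \<in> S" "commrel GXp GXm 1 GH \<in> S"
  shows "reducible_to_normal (ind u)"
proof -
  txt \<open>Resolving a descent with a commutation relation gives a lexicographically smaller word of the
    same length and a shorter word.\<close>
  define R where "R = measure grank"
  have wfR: "wf (lenlex R)" unfolding R_def
    by (intro wf_lenlex wf_measure)
  show ?thesis
  proof (induction u rule: wf_induct_rule[OF wfR])
    case (1 u)
    show ?case
    proof (cases "u \<in> normal_words")
      case True
      thus ?thesis unfolding reducible_to_normal_def
        by (intro exI[of _ "ind u"]) (auto simp: supp_def ind_def zero split: if_splits)
    next
      case False
      then obtain p x y q where u: "u = p @ [x, y] @ q" and xy: "grank y < grank x"
        using nword_if_no_descent[of u] by (meson not_le)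
      \<comment> \<open>The three possible descents \<open>H X^+\<close>, \<open>H X^-\<close> and
        \<open>X^+ X^-\<close> match the three relations.\<close>
      obtain c z where c: "commrel x y c z \<in> S"
        using rels xy by (cases x; cases y) auto
      have "irrefl R" by (auto simp: irrefl_def R_def)
      hence sm: "(p @ [y, x] @ q, u) \<in> lenlex R" "(p @ [z] @ q, u) \<in> lenlex R"
        using xy by (auto simp: u lenlex_conv R_def intro!: lex_append_leftI)
      have "conc (ind p) (conc (commrel x y c z) (ind q)) \<in> S"
        using c by (intro conc_left conc_right) simp_all
      hence "reducible_to_normal (\<lambda>w. ind (p @ [x, y] @ q) w - ind (p @ [y, x] @ q) w - c * ind (p @ [z] @ q) w)"
        unfolding conc_commrel by (rule reducible_if_mem)
      \<comment> \<open>Adding back the swapped word and \<open>c\<close> times the shorter word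
        cancels everything in the relation except \<open>ind u\<close>.\<close>
      from reducible_add[OF this reducible_add[OF 1[OF sm(1)] reducible_smult[OF 1[OF sm(2)], of c]]]
      show ?thesis by (simp add: u cong: if_cong)
    qed
  qed
qed

lemma reducible_all:
  assumes rels: "commrel GH GXp 2 GXp \<in> S" "commrel GH GXm (-2) GXm \<in> S" "commrel GXp GXm 1 GH \<in> S"
    and fin: "finite (supp f)"
  shows "reducible_to_normal f"
proof -
  have "reducible_to_normal (\<lambda>w. \<Sum>u\<in>A. f u * ind u w)" if "finite A" for A
    using that
    by (induction A rule: finite_induct)
      (simp_all add: reducible_if_mem zero reducible_add reducible_smult reducible_ind[OF rels])
  from this[OF fin] show ?thesis
  proof (rule back_subst[of reducible_to_normal], intro ext)
    fix w
    have "(\<Sum>u\<in>supp f. f u * ind u w) = (\<Sum>u\<in>supp f. if u = w then f u else 0)"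
      by (rule sum.cong) (auto simp: ind_def)
    also have "\<dots> = f w" using fin by (simp add: supp_def)
    finally show "(\<Sum>u\<in>supp f. f u * ind u w) = f w" .
  qed
qed

end

subsection \<open>Annihilator and defining ideal\<close>

text \<open>The preimage of \<open>Ann psi\<close> under \<open>canon\<close>, described without
  cosets or chosen representatives.\<close>

definition annFH :: "(nat \<Rightarrow> int \<Rightarrow> 'k::field_char_0 fps) \<Rightarrow> (nat \<Rightarrow> gen list \<Rightarrow> 'k) set" where
  "annFH psi = {f \<in> carrier FH. \<forall>n. \<forall>v\<in>Vcarrier. fhact psi n f v = (\<lambda>k. 0)}"

lemma subgroup_add_FA_I:
  assumes "S \<subseteq> carrier FA" "(\<lambda>w. 0) \<in> S" "\<And>f g. f \<in> S \<Longrightarrow> g \<in> S \<Longrightarrow> (\<lambda>w. f w + g w) \<in> S"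
    "\<And>f. f \<in> S \<Longrightarrow> (\<lambda>w. - f w) \<in> S"
  shows "subgroup S (add_monoid FA)"
proof
  fix f assume f: "f \<in> S"
  hence "inv\<^bsub>add_monoid FA\<^esub> f = (\<lambda>w. - f w)"
    using a_inv_FA[of f] assms(1) by (auto simp: a_inv_def)
  thus "inv\<^bsub>add_monoid FA\<^esub> f \<in> S" using assms(4) f by simp
qed (use assms in \<open>auto simp: FA_simps\<close>)

lemma subgroup_add_FH_I:
  assumes "S \<subseteq> carrier FH" "(\<lambda>m w. 0) \<in> S"
    "\<And>f g. f \<in> S \<Longrightarrow> g \<in> S \<Longrightarrow> (\<lambda>m w. f m w + g m w) \<in> S"
    "\<And>f. f \<in> S \<Longrightarrow> (\<lambda>m w. - f m w) \<in> S"
  shows "subgroup S (add_monoid FH)"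
proof
  fix f assume f: "f \<in> S"
  hence "inv\<^bsub>add_monoid FH\<^esub> f = (\<lambda>m w. - f m w)"
    using a_inv_FH[of f] assms(1) by (auto simp: a_inv_def)
  thus "inv\<^bsub>add_monoid FH\<^esub> f \<in> S" using assms(4) f by simp
qed (use assms in \<open>auto simp: FH_simps\<close>)

lemma fhact_zero: "fhact psi n (\<lambda>m w. 0) v = (\<lambda>k. 0)"
  by (simp add: fhact_eq_hsum)

lemma ideal_annFH:
  fixes psi :: "nat \<Rightarrow> int \<Rightarrow> 'k::field_char_0 fps"
  shows "ideal (annFH psi) FH"
proof (rule idealI[OF ring_FH])
  show "subgroup (annFH psi) (add_monoid FH)"
  proof (rule subgroup_add_FH_I)
    fix f g :: "nat \<Rightarrow> gen list \<Rightarrow> 'k" assume "f \<in> annFH psi" "g \<in> annFH psi"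
    thus "(\<lambda>m w. f m w + g m w) \<in> annFH psi"
      using fhact_add[of f g psi]
      by (auto simp: annFH_def FH_simps FA_simps finite_supp_add fun_eq_iff)
  next
    fix f assume f: "f \<in> annFH psi"
    have z: "(\<lambda>m w. 0 :: 'k) \<in> carrier FH" by (simp add: FH_simps FA_simps)
    have "(\<lambda>m w. - f m w) \<in> carrier FH"
      using f by (auto simp: annFH_def FH_simps FA_simps supp_def)
    thus "(\<lambda>m w. - f m w) \<in> annFH psi"
      using f fhact_diff[OF z, of f psi] by (auto simp: annFH_def fhact_zero fun_eq_iff)
  qed (auto simp: annFH_def fhact_zero FH_simps FA_simps)
next
  fix f x :: "nat \<Rightarrow> gen list \<Rightarrow> 'k" assume f: "f \<in> annFH psi" and x: "x \<in> carrier FH"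
  have c: "f \<in> carrier FH" using f by (simp add: annFH_def)
  have m: "x \<otimes>\<^bsub>FH\<^esub> f \<in> carrier FH" "f \<otimes>\<^bsub>FH\<^esub> x \<in> carrier FH"
    using monoid.m_closed[OF ring.is_monoid[OF ring_FH]] x c by blast+
  show "x \<otimes>\<^bsub>FH\<^esub> f \<in> annFH psi"
    using f m(1) by (simp add: annFH_def fhact_mult[OF x c] fhact_vec_zero)
  show "f \<otimes>\<^bsub>FH\<^esub> x \<in> annFH psi"
    using f m(2) by (simp add: annFH_def fhact_mult[OF c x] Vcarrier_fhact[OF x])
qed

text \<open>The coefficient of \<open>h^p\<close> in the action depends only on the coefficients of
  \<open>f\<close> up to index \<open>p\<close>.\<close>

lemma hclosed_annFH: "hclosed (annFH psi)"
  unfolding hclosed_def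
proof (intro conjI ballI impI)
  fix f assume f: "f \<in> carrier FH" and ap: "\<forall>N. \<exists>g\<in>annFH psi. \<forall>m<N. f m = g m"
  have "fhact psi n f v k = 0" if v: "v \<in> Vcarrier" for n v k
  proof (rule fps_ext)
    fix p
    obtain g where g: "g \<in> annFH psi" "\<forall>m<Suc p. f m = g m" using ap by blast
    hence "fps_nth (fhact psi n f v k) p = fps_nth (fhact psi n g v k) p"
      by (simp add: fhact_eq_hsum)
    thus "fps_nth (fhact psi n f v k) p = fps_nth 0 p" using g v by (simp add: annFH_def)
  qed
  thus "f \<in> annFH psi" using f by (auto simp: annFH_def)
qed (auto simp: annFH_def)

lemma annFH_acts_zero_mod_h:
  assumes "f \<in> annFH psi" "v \<in> Vcarrier"
  shows "fps_nth (faact psi n (f 0) v k) 0 = 0"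
proof -
  have "fps_nth (fhact psi n f v k) 0 = 0" using assms by (simp add: annFH_def)
  thus ?thesis by (simp add: fhact_eq_hsum)
qed

section \<open>The defining relations act by zero\<close>

lemma fhact_hshift_0: "fhact psi n (hshift 0 f) v k = faact psi n f v k"
proof (rule fps_ext)
  fix p
  have "fps_nth (fhact psi n (hshift 0 f) v k) p
      = (\<Sum>m\<in>{0}. fps_nth (faact psi n (hshift 0 f m) v k) (p - m))"
    unfolding fhact_eq_hsum hsum_nth by (rule sum.mono_neutral_right) (auto simp: hshift_def)
  thus "fps_nth (fhact psi n (hshift 0 f) v k) p = fps_nth (faact psi n f v k) p"
    by (simp add: hshift_def)
qed

lemma faact_commrel:
  "faact psi n (commrel x y c z) v k =
     wordact psi n [x, y] v k - wordact psi n [y, x] v k - fps_const c * wordact psi n [z] v k"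
  unfolding commrel_def[abs_def]
  by (simp add: faact_diff faact_smult faact_ind finite_supp_diff finite_supp_smult)

lemma faact_relA:
  "faact psi n relA_Hp v k = 0" "faact psi n relA_Hm v k = 0"
proof -
  have two: "fps_const (2::'a) = 2" "fps_const (-2::'a) = -2"
    by (simp_all add: numeral_fps_const flip: fps_const_neg)
  show "faact psi n relA_Hp v k = 0"
    by (simp add: relA_commrel faact_commrel wordact_Cons letact_def algebra_simps two)
  show "faact psi n relA_Hm v k = 0"
    by (cases k) (simp_all add: relA_commrel faact_commrel wordact_Cons letact_def algebra_simps two)
qed

lemma rel_H_hshift: "rel_Hp = hshift 0 relA_Hp" "rel_Hm = hshift 0 relA_Hm"
  by (auto simp: rel_Hp_def rel_Hm_def hshift_def fun_eq_iff)

lemma relA_carrier: "relA_Hp \<in> carrier FA" "relA_Hm \<in> carrier FA"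
  by (simp_all add: relA_commrel commrel_carrier)

lemma rel_H_in_annFH: "rel_Hp \<in> annFH psi" "rel_Hm \<in> annFH psi"
  by (auto simp: annFH_def rel_H_hshift hshift_carrier relA_carrier fhact_hshift_0 faact_relA)

text \<open>By (C1), modulo \<open>h\<close> the difference of the scalars of \<open>X^+ X^-\<close>
  and \<open>X^- X^+\<close> at index \<open>k\<close> is
  \<open>(k+1)(n-k) - k(n-k+1) = n - 2k\<close>, the weight.\<close>

lemma sl2_acts_zero_mod_h:
  assumes "colouring psi"
  shows "fps_nth (faact psi n (commrel GXp GXm 1 GH) v k) 0 = 0"
proof -
  have psi: "fps_nth (psi t n) 0 = of_int (int t * (n - int t + 1))" if "t \<ge> 1" for t
    using assms that by (auto simp: colouring_def)
  show ?thesis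
    by (cases k) (simp_all add: faact_commrel wordact_Cons letact_def psi fps_of_int_nth_0
        algebra_simps)
qed

text \<open>The bounds lose no terms: \<open>nword a a i\<close> has length \<open>2a + i\<close>,
  so both exponents are at most \<open>length u\<close>.\<close>

definition xi_part :: "(nat \<Rightarrow> int \<Rightarrow> 'k::field_char_0 fps) \<Rightarrow> nat \<Rightarrow> gen list \<Rightarrow> 'k" where
  "xi_part xi m u = (\<Sum>a\<le>length u. \<Sum>i\<le>length u.
     if u = nword a a i then coeff (xipoly xi a m) i else 0)"

lemma rel_XX_eq: "rel_XX xi m = (\<lambda>u. hshift 0 (ind [GXp, GXm]) m u - xi_part xi m u)"
  by (auto simp: rel_XX_def hshift_def xi_part_def nword_def fun_eq_iff)

lemma xi_part_nword: "xi_part xi m (nword a a i) = coeff (xipoly xi a m) i"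
proof -
  have "xi_part xi m (nword a a i) = (\<Sum>a'\<le>a + a + i. \<Sum>i'\<le>a + a + i.
      if a' = a then (if i' = i then coeff (xipoly xi a m) i else 0) else 0)"
    unfolding xi_part_def length_nword by (intro sum.cong refl) (auto simp: nword_eq_iff)
  also have "\<dots> = (\<Sum>a'\<le>a + a + i. if a' = a then (\<Sum>i'\<le>a + a + i. if i' = i then coeff (xipoly xi a m) i else 0) else 0)"
    by (intro sum.cong refl) auto
  also have "\<dots> = coeff (xipoly xi a m) i" by simp
  finally show ?thesis .
qed

lemma xi_part_eq_0: "(\<And>a i. u \<noteq> nword a a i) \<Longrightarrow> xi_part xi m u = 0"
  by (simp add: xi_part_def)

text \<open>Regularity supplies the polynomial that the choice in \<open>xipoly\<close> asks
  for.\<close>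

lemma poly_xipoly:
  assumes "seq_regular xi"
  shows "poly (xipoly xi a m) (of_int n) = fps_nth (xi a n) m"
proof -
  have "\<exists>p. \<forall>n::int. poly p (of_int n) = fps_nth (xi a n) m"
    using assms unfolding seq_regular_def by metis
  from someI_ex[OF this] show ?thesis unfolding xipoly_def by blast
qed

text \<open>Summability makes the values at all integers vanish, and a polynomial with infinitely
  many roots is zero. This makes each coefficient of the infinite sum in the last relation finitely
  supported.\<close>

lemma xipoly_eventually_zero:
  fixes xi :: "nat \<Rightarrow> int \<Rightarrow> 'k::field_char_0 fps"
  assumes "seq_regular xi" "seq_summable xi"
  obtains K where "\<And>a. a \<ge> K \<Longrightarrow> xipoly xi a m = 0"
proof -
  obtain K where K: "\<And>a n. a \<ge> K \<Longrightarrow> fps_nth (xi a n) m = 0"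
    using assms(2) unfolding seq_summable_def by blast
  show ?thesis
  proof
    fix a assume "a \<ge> K"
    hence "range (of_int :: int \<Rightarrow> 'k) \<subseteq> {x. poly (xipoly xi a m) x = 0}"
      using K by (auto simp: poly_xipoly[OF assms(1)])
    moreover have "infinite (range (of_int :: int \<Rightarrow> 'k))"
      using infinite_UNIV_int by (simp add: finite_image_iff inj_on_def)
    ultimately show "xipoly xi a m = 0" by (metis poly_roots_finite finite_subset)
  qed
qed

lemma supp_xi_part:
  assumes "\<And>a. a \<ge> K \<Longrightarrow> xipoly xi a m = 0"
  shows "supp (xi_part xi m) \<subseteq>
    (\<lambda>(a, i). nword a a i) ` (SIGMA a:{..<K}. {..degree (xipoly xi a m)})"
proof
  fix u assume u: "u \<in> supp (xi_part xi m)"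
  then obtain a i where ai: "u = nword a a i" using xi_part_eq_0 unfolding supp_def by blast
  hence c: "coeff (xipoly xi a m) i \<noteq> 0" using u by (simp add: supp_def xi_part_nword)
  hence "i \<le> degree (xipoly xi a m)" by (rule le_degree)
  moreover have "a < K" using c assms[of a] by (cases "a < K") auto
  ultimately show "u \<in> (\<lambda>(a, i). nword a a i) ` (SIGMA a:{..<K}. {..degree (xipoly xi a m)})"
    using ai by force
qed

lemma finite_supp_xi_part:
  assumes "seq_regular xi" "seq_summable xi"
  shows "finite (supp (xi_part xi m))"
proof -
  obtain K where "\<And>a. a \<ge> K \<Longrightarrow> xipoly xi a m = 0"
    using xipoly_eventually_zero[OF assms] by metis
  from supp_xi_part[OF this] show ?thesis by (rule finite_subset) auto
qed

text \<open>The words \<open>nword a a i\<close> preserve the index \<open>k\<close>, and there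
  \<open>H\<close> is the scalar \<open>n - 2k\<close>; summing over \<open>i\<close> therefore
  evaluates the polynomial at that weight. Terms with \<open>a > k\<close> vanish because
  \<open>X^+\<close> runs past index 0.\<close>

lemma faact_xi_part:
  fixes xi :: "nat \<Rightarrow> int \<Rightarrow> 'k::field_char_0 fps"
  assumes "seq_regular xi" "seq_summable xi"
  shows "faact psi n (xi_part xi m) v k =
    (\<Sum>a\<le>k. (\<Prod>b\<in>{k - a + 1..k}. psi b n) * v k * fps_const (fps_nth (xi a (n - 2 * int k)) m))"
proof -
  obtain K0 where K0: "\<And>a. a \<ge> K0 \<Longrightarrow> xipoly xi a m = 0"
    using xipoly_eventually_zero[OF assms] by metis
  \<comment> \<open>Large enough to cover all nonzero polynomials and also every
    \<open>a \<le> k\<close>, so that the sum can be cut to \<open>{..k}\<close> afterwards.\<close>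
  define K where "K = max K0 (Suc k)"
  let ?I = "SIGMA a:{..<K}. {..degree (xipoly xi a m)}"
  let ?x = "of_int (n - 2 * int k) :: 'k"
  have inj: "inj_on (\<lambda>(a, i). nword a a i) ?I" by (auto simp: inj_on_def nword_eq_iff)
  have "faact psi n (xi_part xi m) v k =
      (\<Sum>w\<in>(\<lambda>(a, i). nword a a i) ` ?I. fps_const (xi_part xi m w) * wordact psi n w v k)"
    by (rule faact_superset[OF _ supp_xi_part]) (auto simp: K0 K_def)
  also have "\<dots> = (\<Sum>(a, i)\<in>?I. fps_const (coeff (xipoly xi a m) i) * wordact psi n (nword a a i) v k)"
    by (subst sum.reindex[OF inj]) (auto simp: xi_part_nword intro!: sum.cong)
  also have "\<dots> = (\<Sum>a<K. \<Sum>i\<le>degree (xipoly xi a m).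
      fps_const (coeff (xipoly xi a m) i) * wordact psi n (nword a a i) v k)"
    by (simp add: sum.Sigma)
  also have "\<dots> = (\<Sum>a\<le>k. \<Sum>i\<le>degree (xipoly xi a m).
      fps_const (coeff (xipoly xi a m) i) * wordact psi n (nword a a i) v k)"
    by (rule sum.mono_neutral_right) (auto simp: K_def wordact_nword)
  also have "\<dots> = (\<Sum>a\<le>k. (\<Prod>b\<in>{k - a + 1..k}. psi b n) * v k *
      fps_const (fps_nth (xi a (n - 2 * int k)) m))"
  proof (rule sum.cong[OF refl])
    fix a assume a: "a \<in> {..k}"
    have "fps_const (fps_nth (xi a (n - 2 * int k)) m) = fps_const (poly (xipoly xi a m) ?x)"
      by (simp only: poly_xipoly[OF assms(1)])
    also have "\<dots> = (\<Sum>i\<le>degree (xipoly xi a m). fps_const (coeff (xipoly xi a m) i) * of_int (n - 2 * int k) ^ i)"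
      unfolding poly_altdef fps_const_sum
      by (simp only: fps_const_mult[symmetric] fps_const_power[symmetric] fps_of_int)
    finally show "(\<Sum>i\<le>degree (xipoly xi a m).
        fps_const (coeff (xipoly xi a m) i) * wordact psi n (nword a a i) v k) =
      (\<Prod>b\<in>{k - a + 1..k}. psi b n) * v k * fps_const (fps_nth (xi a (n - 2 * int k)) m)"
      using a by (simp add: wordact_nword sum_distrib_left mult_ac)
  qed
  finally show ?thesis .
qed

lemma rel_XX_carrier:
  assumes "seq_regular xi" "seq_summable xi"
  shows "rel_XX xi \<in> carrier FH"
  unfolding FH_simps FA_simps rel_XX_eq
  by (auto simp: hshift_def intro!: finite_supp_diff finite_supp_xi_part[OF assms]
      simp del: diff_0)

text \<open>Both sides of the relation are diagonal: \<open>X^+ X^-\<close> multiplies coordinate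
  \<open>k\<close> by \<open>shift1 psi k n\<close>, the sum multiplies it by
  \<open>ltimes psi xi k n\<close>.\<close>

lemma rel_XX_in_annFH:
  assumes "seq_regular xi" "seq_summable xi" "\<forall>k n. ltimes psi xi k n = shift1 psi k n"
  shows "rel_XX xi \<in> annFH psi"
proof -
  have xc: "xi_part xi \<in> carrier FH" using finite_supp_xi_part[OF assms(1,2)]
    by (simp add: FH_simps FA_simps)
  have ic: "hshift 0 (ind [GXp, GXm]) \<in> carrier FH" by (rule hshift_carrier) (simp add: FA_simps)
  have "fhact psi n (rel_XX xi) v k = 0" for n v k
  proof -
    have "rel_XX xi = (\<lambda>m u. hshift 0 (ind [GXp, GXm]) m u - xi_part xi m u)"
      by (rule ext) (rule rel_XX_eq)
    hence "fhact psi n (rel_XX xi) v k =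
        wordact psi n [GXp, GXm] v k - fhact psi n (xi_part xi) v k"
      by (simp add: fhact_diff[OF ic xc] fhact_hshift_0 faact_ind)
    also have "fhact psi n (xi_part xi) v k =
        (\<Sum>a\<le>k. (\<Prod>b\<in>{k - a + 1..k}. psi b n) * v k * xi a (n - 2 * int k))"
      by (simp add: fhact_eq_hsum faact_xi_part[OF assms(1,2)] hsum_sum hsum_mult_left hsum_const)
    also have "\<dots> = ltimes psi xi k n * v k"
      by (simp add: ltimes_def sum_distrib_left mult_ac)
    also have "\<dots> = psi (Suc k) n * v k" using assms(3) by (simp add: shift1_def)
    finally show ?thesis by (simp add: wordact_Cons letact_def)
  qed
  thus ?thesis using rel_XX_carrier[OF assms(1,2)] by (auto simp: annFH_def)
qed

section \<open>The closed ideal of relations equals the annihilator\<close>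

locale regular_solution =
  fixes psi xi :: "nat \<Rightarrow> int \<Rightarrow> 'k::field_char_0 fps"
  assumes col: "colouring psi" and reg: "seq_regular xi" and summ: "seq_summable xi"
    and sol: "\<forall>k n. ltimes psi xi k n = shift1 psi k n"
begin

lemma Jideal_subset_annFH: "Jideal xi \<subseteq> annFH psi"
  unfolding Jideal_def
  using ideal_annFH hclosed_annFH rel_H_in_annFH rel_XX_in_annFH[OF reg summ sol]
  by (intro Inter_lower) blast

text \<open>The intersected family is nonempty, since \<open>annFH psi\<close> belongs to
  it.\<close>

lemma ideal_Jideal: "ideal (Jideal xi) FH"
  unfolding Jideal_def
  using ideal_annFH hclosed_annFH rel_H_in_annFH rel_XX_in_annFH[OF reg summ sol]
  by (intro ring.i_Intersect[OF ring_FH]) blast+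

lemma Jideal_closed:
  assumes "f \<in> carrier FH" "\<And>N. \<exists>g\<in>Jideal xi. \<forall>m<N. f m = g m"
  shows "f \<in> Jideal xi"
  unfolding Jideal_def
proof
  fix I assume I: "I \<in> {I. ideal I FH \<and> hclosed I \<and> {rel_Hp, rel_Hm, rel_XX xi} \<subseteq> I}"
  hence "Jideal xi \<subseteq> I" unfolding Jideal_def by (rule Inter_lower)
  hence "\<forall>N. \<exists>g\<in>I. \<forall>m<N. f m = g m" using assms(2) by (meson subsetD)
  moreover have "hclosed I" using I by simp
  ultimately show "f \<in> I" using assms(1) by (simp add: hclosed_def)
qed

lemma rels_in_Jideal: "rel_Hp \<in> Jideal xi" "rel_Hm \<in> Jideal xi" "rel_XX xi \<in> Jideal xi"
  unfolding Jideal_def by blast+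

lemma Jideal_carrier: "f \<in> Jideal xi \<Longrightarrow> f \<in> carrier FH"
  by (rule ideal.Icarr[OF ideal_Jideal])

lemma Jideal_add: "f \<in> Jideal xi \<Longrightarrow> g \<in> Jideal xi \<Longrightarrow> (\<lambda>m w. f m w + g m w) \<in> Jideal xi"
  using additive_subgroup.a_closed[OF ideal.axioms(1)[OF ideal_Jideal], of f g]
  by (simp add: FH_simps)

lemma Jideal_hshift_mult:
  assumes "f \<in> Jideal xi" "a \<in> carrier FA"
  shows "(\<lambda>m. if m < j then (\<lambda>w. 0) else conc a (f (m - j))) \<in> Jideal xi"
  using ideal.I_l_closed[OF ideal_Jideal assms(1) hshift_carrier[OF assms(2)], of j]
  by (simp add: FH_mult_hshift_left)

text \<open>Reduction modulo \<open>h\<close> is onto: an element of the free algebra lifts to the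
  constant series \<open>hshift 0\<close>, so multiplication can be done before reducing.\<close>

lemma ideal_Jideal_mod_h: "ideal ((\<lambda>f. f 0) ` Jideal xi) FA"
proof (rule idealI[OF ring_FA])
  show "subgroup ((\<lambda>f. f 0) ` Jideal xi) (add_monoid FA)"
  proof (rule subgroup_add_FA_I)
    show "(\<lambda>f. f 0) ` Jideal xi \<subseteq> carrier FA"
      using Jideal_carrier by (auto simp: FH_simps)
    show "(\<lambda>w. 0) \<in> (\<lambda>f. f 0) ` Jideal xi"
      using additive_subgroup.zero_closed[OF ideal.axioms(1)[OF ideal_Jideal]]
      by (auto simp: FH_simps intro: rev_image_eqI)
  next
    fix f g assume "f \<in> (\<lambda>f. f 0) ` Jideal xi" "g \<in> (\<lambda>f. f 0) ` Jideal xi"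
    thus "(\<lambda>w. f w + g w) \<in> (\<lambda>f. f 0) ` Jideal xi"
      using Jideal_add by (auto intro: rev_image_eqI)
  next
    fix f assume "f \<in> (\<lambda>f. f 0) ` Jideal xi"
    then obtain F where F: "F \<in> Jideal xi" "f = F 0" by blast
    hence "(\<lambda>m w. - F m w) \<in> Jideal xi"
      using additive_subgroup.a_inv_closed[OF ideal.axioms(1)[OF ideal_Jideal] F(1)]
        a_inv_FH[OF Jideal_carrier[OF F(1)]] by simp
    thus "(\<lambda>w. - f w) \<in> (\<lambda>f. f 0) ` Jideal xi" using F by (auto intro: rev_image_eqI)
  qed
next
  fix f x :: "gen list \<Rightarrow> 'k" assume f: "f \<in> (\<lambda>f. f 0) ` Jideal xi" and x: "x \<in> carrier FA"
  then obtain F where F: "F \<in> Jideal xi" "f = F 0" by blast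
  show "x \<otimes>\<^bsub>FA\<^esub> f \<in> (\<lambda>f. f 0) ` Jideal xi"
    using Jideal_hshift_mult[OF F(1) x, of 0] F(2) by (auto simp: FA_simps intro: rev_image_eqI)
  show "f \<otimes>\<^bsub>FA\<^esub> x \<in> (\<lambda>f. f 0) ` Jideal xi"
    using ideal.I_r_closed[OF ideal_Jideal F(1) hshift_carrier[OF x], of 0] F(2)
    by (auto simp: FA_simps FH_mult_const_right intro: rev_image_eqI)
qed

lemma rel_XX_mod_h: "rel_XX xi 0 = commrel GXp GXm 1 GH"
proof -
  txt \<open>The difference is a combination of normal words acting by zero modulo \<open>h\<close>, so no formula for
    \<open>\<xi>\<close> modulo \<open>h\<close> has to be computed.\<close>
  let ?D = "\<lambda>u. commrel GXp GXm 1 GH u - rel_XX xi 0 u"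
  have fin: "finite (supp (commrel GXp GXm (1::'k) GH))" "finite (supp (rel_XX xi 0))"
    using commrel_carrier[of GXp GXm "1::'k" GH] rel_XX_carrier[OF reg summ]
    by (simp_all add: FH_simps FA_simps)
  \<comment> \<open>The only non-normal word, \<open>X^+ X^-\<close>, cancels; the remaining words
    \<open>X^- X^+\<close> and \<open>H\<close> are normal.\<close>
  have D: "?D u = xi_part xi 0 u - ind (nword 1 1 0) u - ind (nword 0 0 1) u" for u
    by (simp add: rel_XX_eq commrel_def hshift_def nword_def)
  have "?D = (\<lambda>w. 0)"
  proof (rule normal_eq_zero_if_acts_zero[OF col])
    show "finite (supp ?D)" using fin by (rule finite_supp_diff)
    show "supp ?D \<subseteq> normal_words"
    proof
      fix u assume u: "u \<in> supp ?D"
      show "u \<in> normal_words"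
      proof (rule ccontr)
        assume "u \<notin> normal_words"
        hence "u \<noteq> nword a b i" for a b i by (auto simp: normal_words_def)
        hence "?D u = 0" unfolding D by (simp add: xi_part_eq_0 ind_def)
        with u show False by (simp add: supp_def)
      qed
    qed
  next
    fix n k and v :: "nat \<Rightarrow> 'k fps" assume "v \<in> Vcarrier"
    thus "fps_nth (faact psi n ?D v k) 0 = 0"
      using annFH_acts_zero_mod_h[OF rel_XX_in_annFH[OF reg summ sol], of v n k]
      by (simp add: faact_diff[OF fin] sl2_acts_zero_mod_h[OF col])
  qed
  thus ?thesis by (simp add: fun_eq_iff)
qed

text \<open>Rewriting writes \<open>f 0\<close> as \<open>F 0 + g\<close> with \<open>F\<close> in
  the ideal and \<open>g\<close> normal. Both \<open>f 0\<close> and \<open>F 0\<close> act by zero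
  modulo \<open>h\<close>, hence so does \<open>g\<close>, and \<open>g\<close> vanishes.\<close>

lemma annFH_lift_mod_h:
  assumes f: "f \<in> annFH psi"
  obtains F where "F \<in> Jideal xi" "F 0 = f 0"
proof -
  interpret S: fa_ideal "(\<lambda>f. f 0) ` Jideal xi"
    by (rule fa_ideal.intro) (rule ideal_Jideal_mod_h)
  have "hshift 0 g 0 = g" for g :: "gen list \<Rightarrow> 'k" by (simp add: hshift_def)
  hence rels: "commrel GH GXp 2 GXp \<in> (\<lambda>f. f 0) ` Jideal xi"
    "commrel GH GXm (-2) GXm \<in> (\<lambda>f. f 0) ` Jideal xi"
    "commrel GXp GXm 1 GH \<in> (\<lambda>f. f 0) ` Jideal xi"
    using rels_in_Jideal rel_XX_mod_h unfolding rel_H_hshift relA_commrel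
    by (metis image_eqI)+
  have fin: "finite (supp (f 0))" using f by (simp add: annFH_def FH_simps FA_simps)
  from S.reducible_all[OF rels fin] obtain g F where g: "finite (supp g)" "supp g \<subseteq> normal_words"
    and F: "F \<in> Jideal xi" "(\<lambda>w. f 0 w - g w) = F 0"
    unfolding S.reducible_to_normal_def by blast
  have finF: "finite (supp (F 0))" using Jideal_carrier[OF F(1)] by (simp add: FH_simps FA_simps)
  have g_eq: "g = (\<lambda>w. f 0 w - F 0 w)" using F(2) by (metis diff_diff_eq2 add_diff_cancel_left')
  have "g = (\<lambda>w. 0)"
  proof (rule normal_eq_zero_if_acts_zero[OF col g])
    fix n k and v :: "nat \<Rightarrow> 'k fps" assume v: "v \<in> Vcarrier"
    show "fps_nth (faact psi n g v k) 0 = 0"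
      using annFH_acts_zero_mod_h[OF f v] annFH_acts_zero_mod_h[OF _ v] F(1) Jideal_subset_annFH
      by (auto simp: g_eq faact_diff[OF fin finF])
  qed
  with F show ?thesis by (intro that[of F]) auto
qed

lemma annFH_approx:
  assumes "f \<in> annFH psi"
  shows "\<exists>g\<in>Jideal xi. \<forall>m<N. f m = g m"
  using assms
proof (induction N arbitrary: f)
  case 0
  show ?case using rels_in_Jideal(1) by auto
next
  case (Suc N)
  obtain F where F: "F \<in> Jideal xi" "F 0 = f 0" using annFH_lift_mod_h[OF Suc.prems] .
  have Fa: "F \<in> annFH psi" using F(1) Jideal_subset_annFH by blast
  have c: "f \<in> carrier FH" "F \<in> carrier FH" using Suc.prems Fa by (simp_all add: annFH_def)
  \<comment> \<open>This is \<open>(f - F) / h\<close>, as the constant terms agree.\<close>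
  define f' where "f' = (\<lambda>m w. f (Suc m) w - F (Suc m) w)"
  have "f' \<in> annFH psi"
    unfolding annFH_def
  proof (intro CollectI conjI allI ballI ext)
    show "f' \<in> carrier FH" using c by (simp add: f'_def FH_simps FA_simps finite_supp_diff)
    fix n k and v :: "nat \<Rightarrow> 'k fps" assume v: "v \<in> Vcarrier"
    have "0 = fhact psi n (\<lambda>m w. f m w - F m w) v k"
      using Suc.prems Fa v by (simp add: fhact_diff[OF c] annFH_def)
    also have "\<dots> = fps_X * fhact psi n f' v k"
      unfolding fhact_eq_hsum by (subst hsum_shift) (simp_all add: F(2) f'_def)
    finally show "fhact psi n f' v k = 0" by simp
  qed
  from Suc.IH[OF this] obtain g' where g': "g' \<in> Jideal xi" "\<forall>m<N. f' m = g' m" by blast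
  \<comment> \<open>This is \<open>h g'\<close>; the new approximation is \<open>F + h g'\<close>,
    which gains one power of \<open>h\<close>.\<close>
  have "(\<lambda>m. if m < 1 then (\<lambda>w. 0) else g' (m - 1)) \<in> Jideal xi"
    using Jideal_hshift_mult[OF g'(1), of "ind []" 1] by (simp add: FA_simps cong: if_cong)
  from Jideal_add[OF F(1) this] show ?case
  proof (rule rev_bexI, intro allI impI)
    fix m assume m: "m < Suc N"
    show "f m = (\<lambda>w. F m w + (if m < 1 then (\<lambda>w. 0) else g' (m - 1)) w)"
    proof (cases m)
      case 0
      thus ?thesis using F(2) by simp
    next
      case (Suc j)
      hence "f' j = g' j" using g'(2) m by simp
      thus ?thesis using Suc by (auto simp: f'_def fun_eq_iff algebra_simps)
    qed
  qed
qed

lemma Jideal_eq_annFH: "Jideal xi = annFH psi"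
proof
  show "annFH psi \<subseteq> Jideal xi"
    using annFH_approx by (auto intro!: Jideal_closed simp: annFH_def)
qed (rule Jideal_subset_annFH)

end

subsection \<open>The isomorphism\<close>

lemma ideal_Ia: "ideal Ia FA"
  unfolding Ia_def by (rule ring.genideal_ideal[OF ring_FA]) (simp add: relA_carrier)

lemma ring_Ua: "ring Ua"
  unfolding Ua_def by (rule ideal.quotient_is_ring[OF ideal_Ia])

lemma coset_Ia_hom: "a_r_coset FA Ia \<in> ring_hom FA Ua"
  unfolding Ua_def by (rule ideal.rcos_ring_hom[OF ideal_Ia])

lemma coset_Ia_zero: "a_r_coset FA Ia (\<lambda>w. 0) = \<zero>\<^bsub>Ua\<^esub>"
  using ring_hom_zero[OF coset_Ia_hom ring_FA ring_Ua] by (simp add: FA_simps)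

lemma finsum_Ua:
  fixes g :: "'i \<Rightarrow> gen list \<Rightarrow> 'k::field_char_0"
  assumes "finite A" "\<And>i. i \<in> A \<Longrightarrow> g i \<in> carrier FA"
  shows "finsum Ua (\<lambda>i. a_r_coset FA Ia (g i)) A = a_r_coset FA Ia (\<lambda>w. \<Sum>i\<in>A. g i w)"
  using assms
proof (induction A rule: finite_induct)
  case empty
  interpret R: ring "Ua :: (gen list \<Rightarrow> 'k) set ring" by (rule ring_Ua)
  show ?case by (simp add: coset_Ia_zero)
next
  case (insert x A)
  interpret R: ring "Ua :: (gen list \<Rightarrow> 'k) set ring" by (rule ring_Ua)
  have c: "a_r_coset FA Ia (g i) \<in> carrier Ua" if "i \<in> insert x A" for i
    using that insert.prems ring_hom_closed[OF coset_Ia_hom] by blast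
  have s: "(\<lambda>w. \<Sum>i\<in>A. g i w) \<in> carrier FA"
    using insert.prems by (simp add: FA_simps finite_supp_sum)
  have "finsum Ua (\<lambda>i. a_r_coset FA Ia (g i)) (insert x A) =
      a_r_coset FA Ia (g x) \<oplus>\<^bsub>Ua\<^esub> a_r_coset FA Ia (\<lambda>w. \<Sum>i\<in>A. g i w)"
    using insert c by (subst R.finsum_insert) auto
  also have "\<dots> = a_r_coset FA Ia (g x \<oplus>\<^bsub>FA\<^esub> (\<lambda>w. \<Sum>i\<in>A. g i w))"
    using ring_hom_add[OF coset_Ia_hom _ s, of "g x"] insert.prems by simp
  finally show ?case using insert.hyps by (simp add: FA_simps)
qed

lemma canon_hom: "canon \<in> ring_hom FH (Uh :: (nat \<Rightarrow> (gen list \<Rightarrow> 'k::field_char_0) set) ring)"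
proof (rule ring_hom_memI)
  fix f g :: "nat \<Rightarrow> gen list \<Rightarrow> 'k"
  assume f: "f \<in> carrier FH"
  hence fc: "f m \<in> carrier FA" for m by (simp add: FH_simps)
  show "canon f \<in> carrier Uh"
    using ring_hom_closed[OF coset_Ia_hom fc] by (simp add: Uh_def canon_def)
  assume g: "g \<in> carrier FH"
  hence gc: "g m \<in> carrier FA" for m by (simp add: FH_simps)
  show "canon (f \<oplus>\<^bsub>FH\<^esub> g) = canon f \<oplus>\<^bsub>Uh\<^esub> canon g"
    using ring_hom_add[OF coset_Ia_hom fc gc] by (simp add: Uh_def canon_def FH_simps FA_simps)
  show "canon (f \<otimes>\<^bsub>FH\<^esub> g) = canon f \<otimes>\<^bsub>Uh\<^esub> canon g"
  proof
    fix m
    have "canon (f \<otimes>\<^bsub>FH\<^esub> g) m = a_r_coset FA Ia (\<lambda>w. \<Sum>i\<le>m. (f i \<otimes>\<^bsub>FA\<^esub> g (m - i)) w)"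
      by (simp add: canon_def FH_simps FA_simps)
    also have "\<dots> = finsum Ua (\<lambda>i. a_r_coset FA Ia (f i \<otimes>\<^bsub>FA\<^esub> g (m - i))) {..m}"
      using fc gc by (intro finsum_Ua[symmetric]) (auto simp: FA_simps finite_supp_conc)
    also have "\<dots> = (canon f \<otimes>\<^bsub>Uh\<^esub> canon g) m"
      by (simp add: Uh_def canon_def ring_hom_mult[OF coset_Ia_hom fc gc])
    finally show "canon (f \<otimes>\<^bsub>FH\<^esub> g) m = (canon f \<otimes>\<^bsub>Uh\<^esub> canon g) m" .
  qed
next
  show "canon \<one>\<^bsub>FH\<^esub> = \<one>\<^bsub>Uh :: (nat \<Rightarrow> (gen list \<Rightarrow> 'k) set) ring\<^esub>"
    using ring_hom_one[OF coset_Ia_hom]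
    by (auto simp: Uh_def canon_def FH_simps FA_simps coset_Ia_zero fun_eq_iff)
qed

lemma canon_surj: "canon ` carrier FH = carrier Uh"
proof
  show "canon ` carrier FH \<subseteq> carrier Uh" using ring_hom_closed[OF canon_hom] by blast
  show "carrier Uh \<subseteq> canon ` carrier FH"
  proof
    fix u assume "u \<in> carrier Uh"
    hence "\<forall>m. \<exists>f\<in>carrier FA. u m = a_r_coset FA Ia f"
      by (auto simp: Uh_def Ua_def FactRing_def A_RCOSETS_def')
    then obtain f where f: "\<And>m. f m \<in> carrier FA" "\<And>m. u m = a_r_coset FA Ia (f m)" by metis
    thus "u \<in> canon ` carrier FH"
      by (intro image_eqI[of _ _ f]) (auto simp: canon_def FH_simps)
  qed
qed

lemma canon_zero: "canon \<zero>\<^bsub>FH\<^esub> = \<zero>\<^bsub>Uh\<^esub>"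
  by (simp add: Uh_def canon_def FH_simps coset_Ia_zero)

text \<open>The ring axioms are transported along \<open>canon\<close>, whose image ring has the
  carrier and the zero of \<open>Uh\<close>.\<close>

lemma ring_Uh: "ring Uh"
  using ring.ring_hom_imp_img_ring[OF ring_FH canon_hom]
  by (simp add: canon_surj canon_zero)

lemma canon_ring_hom_ring: "ring_hom_ring FH Uh canon"
  by (rule ring_hom_ringI2[OF ring_FH ring_Uh canon_hom])

section \<open>Comparison of the annihilators in \<open>FH\<close> and in \<open>Uh\<close>\<close>

lemma Ia_acts_zero:
  assumes "f \<in> Ia"
  shows "faact psi n f v = (\<lambda>k. 0)"
proof -
  \<comment> \<open>An ideal containing both generators of \<open>Ia\<close>, hence containing the
    smallest such ideal.\<close>
  let ?A = "{f \<in> carrier FA. \<forall>v. faact psi n f v = (\<lambda>k. 0)}"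
  have z: "faact psi n f (\<lambda>k. 0) = (\<lambda>k. 0)" for f
    using fhact_vec_zero[of psi n "hshift 0 f"] by (simp add: fhact_hshift_0 fun_eq_iff)
  have "ideal ?A FA"
  proof (rule idealI[OF ring_FA])
    show "subgroup ?A (add_monoid FA)"
    proof (rule subgroup_add_FA_I)
      fix f assume "f \<in> ?A"
      thus "(\<lambda>w. - f w) \<in> ?A"
        using faact_smult[of psi n "-1" f] by (auto simp: FA_simps supp_def fun_eq_iff)
    qed (auto simp: FA_simps finite_supp_add faact_add fun_eq_iff)
  qed (auto simp: FA_simps finite_supp_conc faact_conc z)
  moreover have "{relA_Hp, relA_Hm} \<subseteq> ?A"
    by (auto simp: relA_carrier faact_relA)
  ultimately have "Ia \<subseteq> ?A"
    unfolding Ia_def by (rule ring.genideal_minimal[OF ring_FA])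
  thus ?thesis using assms by blast
qed

text \<open>Whichever representative is chosen differs from \<open>f m\<close> by an element of
  \<open>Ia\<close>, which acts by zero.\<close>

lemma uhact_canon:
  assumes "f \<in> carrier FH"
  shows "uhact psi n (canon f) v = fhact psi n f v"
proof -
  have "faact psi n (rep (canon f m)) v k = faact psi n (f m) v k" for m k
  proof -
    have fm: "f m \<in> carrier FA" using assms by (simp add: FH_simps)
    have "f m \<in> a_r_coset FA Ia (f m)"
      using additive_subgroup.zero_closed[OF ideal.axioms(1)[OF ideal_Ia]]
      by (auto simp: a_r_coset_def' FA_simps intro!: bexI[of _ "\<lambda>w. 0"])
    hence "rep (canon f m) \<in> a_r_coset FA Ia (f m)"
      unfolding rep_def canon_def by (rule someI[of "\<lambda>g. g \<in> a_r_coset FA Ia (f m)"])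
    then obtain i where i: "i \<in> Ia" "rep (canon f m) = (\<lambda>w. i w + f m w)"
      by (auto simp: a_r_coset_def' FA_simps)
    have "i \<in> carrier FA" using i(1) by (rule ideal.Icarr[OF ideal_Ia])
    thus ?thesis using fm by (simp add: i faact_add FA_simps Ia_acts_zero[OF i(1)])
  qed
  thus ?thesis by (simp add: uhact_def fhact_eq_hsum)
qed

lemma canon_in_Ann_iff:
  assumes "f \<in> carrier FH"
  shows "canon f \<in> Ann psi \<longleftrightarrow> f \<in> annFH psi"
  using assms ring_hom_closed[OF canon_hom assms]
  by (simp add: Ann_def annFH_def uhact_canon)

text \<open>Lets \<open>Ann psi\<close> inherit the ideal property as the image of an ideal under a
  surjective homomorphism.\<close>

lemma Ann_eq_image: "Ann psi = canon ` annFH psi"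
proof
  show "canon ` annFH psi \<subseteq> Ann psi"
    using canon_in_Ann_iff by (auto simp: annFH_def)
  show "Ann psi \<subseteq> canon ` annFH psi"
  proof
    fix u assume u: "u \<in> Ann psi"
    hence "u \<in> canon ` carrier FH" by (simp add: canon_surj Ann_def)
    then obtain f where "f \<in> carrier FH" "u = canon f" by blast
    with u show "u \<in> canon ` annFH psi" using canon_in_Ann_iff by blast
  qed
qed

lemma (in ring_hom_ring) ideal_image:
  assumes surj: "h ` carrier R = carrier S" and I: "ideal I R"
  shows "ideal (h ` I) S"
proof (rule idealI[OF S.ring_axioms])
  show "subgroup (h ` I) (add_monoid S)"
    by (rule img_is_add_subgroup[OF additive_subgroup.a_subgroup[OF ideal.axioms(1)[OF I]]])
  fix a x assume "a \<in> h ` I" and "x \<in> carrier S"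
  then obtain i r where i: "i \<in> I" "a = h i" and r: "r \<in> carrier R" "x = h r"
    using surj by blast
  have "i \<in> carrier R" by (rule ideal.Icarr[OF I i(1)])
  thus "x \<otimes>\<^bsub>S\<^esub> a \<in> h ` I" "a \<otimes>\<^bsub>S\<^esub> x \<in> h ` I"
    using i r ideal.I_l_closed[OF I i(1) r(1)] ideal.I_r_closed[OF I i(1) r(1)]
    by (metis hom_mult image_eqI)+
qed

lemma ideal_Ann: "ideal (Ann psi) Uh"
  unfolding Ann_eq_image
  by (rule ring_hom_ring.ideal_image[OF canon_ring_hom_ring canon_surj ideal_annFH])

theorem mainTheorem8:
  fixes psi xi :: "nat \<Rightarrow> int \<Rightarrow> 'k::field_char_0 fps"
  assumes "regular_colouring psi"
    and "seq_regular xi" and "seq_summable xi"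
    and "\<forall>k n. ltimes psi xi k n = shift1 psi k n"
  shows "\<exists>\<phi>. \<phi> \<in> ring_iso (FH Quot Jideal xi) (Upsi psi) \<and>
           (\<forall>f\<in>carrier FH. \<phi> (a_r_coset FH (Jideal xi) f) = a_r_coset Uh (Ann psi) (canon f))"
proof -
  interpret regular_solution psi xi
    using assms by (intro regular_solution.intro) (auto simp: regular_colouring_def)
  interpret A: ideal "Ann psi" Uh by (rule ideal_Ann)
  let ?h = "a_r_coset Uh (Ann psi) \<circ> canon"
  have "?h \<in> ring_hom FH (Upsi psi)"
    unfolding Upsi_def by (rule ring_hom_trans[OF canon_hom A.rcos_ring_hom])
  then interpret h: ring_hom_ring FH "Upsi psi" ?h
    unfolding Upsi_def by (intro ring_hom_ringI2 ring_FH A.quotient_is_ring)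
  have surj: "?h ` carrier FH = carrier (Upsi psi)"
    unfolding image_comp[symmetric] canon_surj
    by (auto simp: Upsi_def FactRing_def A_RCOSETS_def')
  have "?h f = \<zero>\<^bsub>Upsi psi\<^esub> \<longleftrightarrow> f \<in> annFH psi" if f: "f \<in> carrier FH" for f
  proof -
    have c: "canon f \<in> carrier Uh" by (rule ring_hom_closed[OF canon_hom f])
    have "?h f = \<zero>\<^bsub>Upsi psi\<^esub> \<longleftrightarrow> canon f \<in> Ann psi"
      using A.a_rcos_const A.rcos_const_imp_mem[OF c] by (auto simp: Upsi_def FactRing_def)
    thus ?thesis by (simp add: canon_in_Ann_iff[OF f])
  qed
  \<comment> \<open>The equality of the two ideals enters here and identifies the kernel of the
    composite.\<close>
  hence ker: "a_kernel FH (Upsi psi) ?h = Jideal xi"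
    unfolding Jideal_eq_annFH a_kernel_def' by (auto simp: annFH_def)
  \<comment> \<open>First isomorphism theorem; the induced map takes the single value of
    \<open>?h\<close> on a coset, which gives the required formula on classes.\<close>
  show ?thesis
    using h.FactRing_iso_set[OF surj] h.the_elem_simp unfolding ker by auto
qed

end
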